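(* Let $D,K,(s^k),(\alpha_a^k),(\beta_a^k),\boldsymbol{b}$ be data as in the context, let $\mathcal{T}=(T^k)_{k\in K}$ where $T^k\subseteq A^k$ is an $s^k$-arborescence of $(V^k,A^k)$, and let $\boldsymbol{e}=(e_a^k)$ be defined by $e_a^k=1$ if $a\notin T^k$ and $e_a^k=0$ if $a\in T^k$. Under the non-degeneracy assumption for the program $AMNEP(\boldsymbol{e})$, the network Lemke-like algorithm (described in the context) solves the problem $MNEP$: it terminates with a feasible complementary basis not containing $o$, whose associated basic solution $(\bar{\boldsymbol{x}},\bar{\boldsymbol{\mu}},0,\bar{\boldsymbol{\pi}})$ provides a solution $(\bar{\boldsymbol{x}},\bar{\boldsymbol{\mu}},\bar{\boldsymbol{\pi}})$ of $MNEP$.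
   Context: Data. $D=(V,A)$ is a finite directed graph (parallel arcs allowed), $K$ a finite set of classes, and for each $k\in K$, $s^k\in V$, $V^k$ is the set of vertices reachable from $s^k$ and $A^k$ the set of arcs reachable from $s^k$ (arcs $(u,v)$ with $u\in V^k$); $\delta^+(v),\delta^-(v)$ denote outgoing/incoming arcs (within $A^k$ for class $k$). For $k\in K$, $a\in A^k$: $\alpha_a^k\in\mathbb{Q}_+\setminus\{0\}$, $\beta_a^k\in\mathbb{Q}_+$ (class $k$ has affine cost $\alpha_a^kx+\beta_a^k$ on arc $a$). $\boldsymbol{b}=(b_v^k)_{k\in K,v\in V^k}$ is a given vector with $\sum_{v\in V^k}b_v^k=0$ for all $k$ (the equilibrium problem with demands $\lambda(I^k)$ and destinations $t^k$ corresponds to $b_{s^k}^k=\lambda(I^k)$, $b_{t^k}^k=-\lambda(I^k)$, $b_v^k=0$ otherwise). Convention: $x_a^{k}=0$ if $a\notin A^{k}$. $MNEP$: find $x_a^k\ge0$, $\mu_a^k\ge 0$, $\pi_v^k\in\mathbb{R}$ ($k\in K,a\in A^k,v\in V^k$) with $\sum_{a\in\delta^+(v)}x_a^k=\sum_{a\in\delta^-(v)}x_a^k+b_v^k$ ($k\in K,v\in V^k$); $\alpha_{uv}^k\sum_{k'\in K}x_{uv}^{k'}+\pi_u^k-\pi_v^k-\mu_{uv}^k=-\beta_{uv}^k$ ($k\in K,(u,v)\in A^k$); $x_a^k\mu_a^k=0$ ($k\in K,a\in A^k$); $\pi_{s^k}^k=0$ ($k\in K$). $AMNEP(\boldsymbol{e})$,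 for $\boldsymbol{e}=(e_a^k)_{k\in K,a\in A^k}$: minimize $\omega$ over $\omega\ge0$, $x_a^k\ge0$, $\mu_a^k\ge0$, $\pi_v^k\in\mathbb{R}$ subject to the same constraints except that the second family is replaced by $\alpha_{uv}^k\sum_{k'\in K}x_{uv}^{k'}+\pi_u^k-\pi_v^k-\mu_{uv}^k+e_{uv}^k\omega=-\beta_{uv}^k$. Matrix form. $\boldsymbol{\pi}=(\pi_v^k)_{k\in K, v\in V^k\setminus\{s^k\}}$. $M=\operatorname{diag}((M^k)_{k\in K})$ where $M^k$ is the incidence matrix of $(V^k,A^k)$ with the $s^k$-row removed ($M^k_{v,a}=1$ if $a\in\delta^+(v)$, $-1$ if $a\in\delta^-(v)$, $0$ otherwise). $C$ is the matrix with rows and columns indexed by the pairs $(a,k)$, $k\in K,a\in A^k$, with entry $\alpha_a^k$ at row $(a,k)$ and column $(a,k')$ for all $k'$ with $a\in A^{k'}$, and $0$ elsewhere. Let $\overline{M}^{\boldsymbol{e}}=\begin{pmatrix} M & 0 & 0 \\ C & -I & \boldsymbol{e} \end{pmatrix}$. The linear constraints of $AMNEP(\boldsymbol{e})$ are $\overline{M}^{\boldsymbol{e}}(\boldsymbol{x},\boldsymbol{\mu},\omega)^T+\begin{pmatrix} 0 \\ M^T \end{pmatrix}\boldsymbol{\pi}=\begin{pmatrix} \boldsymbol{b} \\ -\boldsymbol{\beta} \end{pmatrix}$ (with the $s^k$-entries of $\boldsymbol{b}$ dropped). Bases. $\mathcal{X}$ and $\mathcal{M}$ are disjoint copies of $\{(a,k):k\in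 K,a\in A^k\}$, the elements corresponding to $(a,k)$ being $\phi^x(a,k)\in\mathcal{X}$ and $\phi^\mu(a,k)\in\mathcal{M}$; they index the $x$- and $\mu$-columns of $\overline{M}^{\boldsymbol{e}}$, and an extra element $o$ indexes the $\omega$-column. A basis is a set $B\subseteq\mathcal{X}\cup\mathcal{M}\cup\{o\}$ such that the matrix $\left(\overline{M}^{\boldsymbol{e}}_B\;\Big|\;\begin{smallmatrix} 0 \\ M^T \end{smallmatrix}\right)$ is square and nonsingular ($\overline{M}^{\boldsymbol{e}}_B$ being the submatrix of columns indexed by $B$); so $|B|=\sum_k|A^k|$. Its basic solution $(\bar{\boldsymbol{x}},\bar{\boldsymbol{\mu}},\bar\omega,\bar{\boldsymbol{\pi}})$ is the unique solution of the linear constraints whose $x$-, $\mu$-, $\omega$-components indexed outside $B$ are zero. $B$ is feasible if $\bar{\boldsymbol{x}},\bar{\boldsymbol{\mu}},\bar\omega\ge0$. $B$ is complementary if for every $(a,k)$, not both $\phi^x(a,k)$ and $\phi^\mu(a,k)$ are in $B$. The non-degeneracy assumption for $AMNEP(\boldsymbol{e})$: for every feasible basis $B$, $\bar x_a^k>0$ whenever $\phi^x(a,k)\in B$ and $\bar\mu_a^k>0$ whenever $\phi^\mu(a,k)\in B$. If $B$ is complementary and $o\in B$, there is exactly one $(a_0,k_0)$ with $\phi^x(a_0,k_0)\notin B$ and $\phi^\mu(a_0,k_0)\notin B$; these two elements are the twin indices of $B$. If $B$ is complementary and $o\notin B$, there are no twin indices. An $s$-arborescence is a spanning tree rooted at $s$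 containing a directed path from $s$ to every vertex. Network Lemke-like algorithm. Let $Y=\{\phi^x(a,k):k\in K,a\in T^k\}\cup\{\phi^\mu(a,k):k\in K,a\in A^k\setminus T^k\}\cup\{o\}$. If $Y\setminus\{o\}$ is a complementary feasible basis providing an optimal solution of $AMNEP(\boldsymbol{e})$ with $\omega=0$, stop with it. Otherwise take $(a_0,k_0)$ such that $B^{ini}=Y\setminus\{\phi^\mu(a_0,k_0)\}$ is a feasible complementary basis, and start with current basis $B=B^{ini}$ and entering index $i=\phi^x(a_0,k_0)$. Repeat: find the unique index $j\neq i$ such that $B\cup\{i\}\setminus\{j\}$ is a feasible complementary basis, and replace $B$ by $B\cup\{i\}\setminus\{j\}$ (a pivot); if $B$ has no twin indices, stop with $B$; otherwise $j$ is one of the twin indices of $B$, and let the new entering index $i$ be the other twin index. Finally, compute the basic solution associated to the last basis.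
   Formalization: Added assumption: for each class k the flow on the arborescence T^k meeting the demands b is nonnegative; otherwise no starting basis exists (e.g. one arc s→t with b_s=-1, b_t=1, where MNEP is infeasible). It holds automatically when b_v^k ≤ 0 for all v ≠ s^k. *)

theory Defs
  imports Complex_Main "Graph_Theory.Digraph_Component"
begin

section \<open>Networks\<close>

record ('v, 'a, 'k) network =
  graph :: "('v, 'a) pre_digraph"
  classes :: "'k set"
  source :: "'k \<Rightarrow> 'v"
  slope :: "'k \<Rightarrow> 'a \<Rightarrow> real"      \<comment> \<open>\<open>\<alpha>\<close>\<close>
  offset :: "'k \<Rightarrow> 'a \<Rightarrow> real"     \<comment> \<open>\<open>\<beta>\<close>\<close>
  demand :: "'k \<Rightarrow> 'v \<Rightarrow> real"     \<comment> \<open>\<open>b\<close>; positive means that flow is injected\<close>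

text \<open>The digraph \<open>(V\<^sup>k, A\<^sup>k)\<close>; the head of an arc of \<open>A\<^sup>k\<close> is again in \<open>V\<^sup>k\<close>.\<close>

definition class_graph :: "('v, 'a, 'k) network \<Rightarrow> 'k \<Rightarrow> ('v, 'a) pre_digraph" where
  "class_graph N k =
    (let V = {v. source N k \<rightarrow>\<^sup>*\<^bsub>graph N\<^esub> v} in
     \<lparr>verts = V, arcs = {a \<in> arcs (graph N). tail (graph N) a \<in> V},
      tail = tail (graph N), head = head (graph N)\<rparr>)"

abbreviation class_verts :: "('v, 'a, 'k) network \<Rightarrow> 'k \<Rightarrow> 'v set" where
  "class_verts N k \<equiv> verts (class_graph N k)"

abbreviation class_arcs :: "('v, 'a, 'k) network \<Rightarrow> 'k \<Rightarrow> 'a set" where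
  "class_arcs N k \<equiv> arcs (class_graph N k)"

locale multiclass_network =
  fixes N :: "('v, 'a, 'k) network"
  assumes fin_digraph: "fin_digraph (graph N)"
    and finite_classes: "finite (classes N)"
    and source_in_verts: "k \<in> classes N \<Longrightarrow> source N k \<in> verts (graph N)"
    and slope_rat: "k \<in> classes N \<Longrightarrow> a \<in> class_arcs N k \<Longrightarrow> slope N k a \<in> \<rat>"
    and slope_pos: "k \<in> classes N \<Longrightarrow> a \<in> class_arcs N k \<Longrightarrow> slope N k a > 0"
    and offset_rat: "k \<in> classes N \<Longrightarrow> a \<in> class_arcs N k \<Longrightarrow> offset N k a \<in> \<rat>"
    and offset_nonneg: "k \<in> classes N \<Longrightarrow> a \<in> class_arcs N k \<Longrightarrow> offset N k a \<ge> 0"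
    and demand_sum: "k \<in> classes N \<Longrightarrow> (\<Sum>v\<in>class_verts N k. demand N k v) = 0"

definition pairs :: "('v, 'a, 'k) network \<Rightarrow> ('a \<times> 'k) set" where
  "pairs N = {(a, k). k \<in> classes N \<and> a \<in> class_arcs N k}"

text \<open>The index set of \<open>\<pi>\<close>, and of the rows of \<open>M\<close>.\<close>

definition nonsource :: "('v, 'a, 'k) network \<Rightarrow> ('v \<times> 'k) set" where
  "nonsource N = {(v, k). k \<in> classes N \<and> v \<in> class_verts N k - {source N k}}"

section \<open>Arborescences\<close>

text \<open>
  The library predicates \<^const>\<open>forest\<close> and \<^const>\<open>tree\<close> exclude directed cycles only, so that
  they hold of every connected acyclic digraph. Being a tree is a property of the underlying
  undirected multigraph; we walk in the latter by giving each arc two orientations, and a cycle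
  may not use an arc twice.
\<close>

definition bidirect :: "('v, 'a) pre_digraph \<Rightarrow> ('v, 'a \<times> bool) pre_digraph" where
  "bidirect H =
    \<lparr>verts = verts H, arcs = arcs H \<times> UNIV,
     tail = (\<lambda>(a, forward). if forward then tail H a else head H a),
     head = (\<lambda>(a, forward). if forward then head H a else tail H a)\<rparr>"

definition undirected_forest :: "('v, 'a) pre_digraph \<Rightarrow> bool" where
  "undirected_forest H \<longleftrightarrow>
    \<not> (\<exists>p. pre_digraph.cycle (bidirect H) p \<and> distinct (map fst p))"

definition undirected_tree :: "('v, 'a) pre_digraph \<Rightarrow> bool" where
  "undirected_tree H \<longleftrightarrow> Digraph_Component.connected H \<and> undirected_forest H"

definition arborescence :: "('v, 'a) pre_digraph \<Rightarrow> 'v \<Rightarrow> 'a set \<Rightarrow> bool" where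
  "arborescence G r T \<longleftrightarrow>
    spanning (G\<lparr>arcs := T\<rparr>) G \<and> undirected_tree (G\<lparr>arcs := T\<rparr>) \<and>
    (\<forall>v\<in>verts G. r \<rightarrow>\<^sup>*\<^bsub>G\<lparr>arcs := T\<rparr>\<^esub> v)"

section \<open>The two equilibrium problems\<close>

definition flow_conservation ::
    "('v, 'a, 'k) network \<Rightarrow> ('a \<times> 'k \<Rightarrow> real) \<Rightarrow> bool" where
  "flow_conservation N x \<longleftrightarrow>
    (\<forall>k\<in>classes N. \<forall>v\<in>class_verts N k.
      (\<Sum>a\<in>out_arcs (class_graph N k) v. x (a, k)) =
      (\<Sum>a\<in>in_arcs (class_graph N k) v. x (a, k)) + demand N k v)"

text \<open>The restriction of the sum implements the convention that \<open>x\<close> vanishes at \<open>(a, k')\<close> if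
  \<open>a\<close> is not an arc of class \<open>k'\<close>.\<close>

definition total_flow ::
    "('v, 'a, 'k) network \<Rightarrow> ('a \<times> 'k \<Rightarrow> real) \<Rightarrow> 'a \<Rightarrow> real" where
  "total_flow N x a = (\<Sum>k'\<in>{k'\<in>classes N. a \<in> class_arcs N k'}. x (a, k'))"

definition MNEP_solution ::
    "('v, 'a, 'k) network \<Rightarrow> ('a \<times> 'k \<Rightarrow> real) \<Rightarrow> ('a \<times> 'k \<Rightarrow> real) \<Rightarrow>
     ('v \<times> 'k \<Rightarrow> real) \<Rightarrow> bool" where
  "MNEP_solution N x \<mu> \<pi> \<longleftrightarrow>
    (\<forall>p\<in>pairs N. x p \<ge> 0 \<and> \<mu> p \<ge> 0) \<and>
    flow_conservation N x \<and>
    (\<forall>(a, k)\<in>pairs N.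
      slope N k a * total_flow N x a + \<pi> (tail (graph N) a, k) - \<pi> (head (graph N) a, k)
        - \<mu> (a, k) = - offset N k a) \<and>
    (\<forall>p\<in>pairs N. x p * \<mu> p = 0) \<and>
    (\<forall>k\<in>classes N. \<pi> (source N k, k) = 0)"

type_synonym ('v, 'a, 'k) point =
  "('a \<times> 'k \<Rightarrow> real) \<times> ('a \<times> 'k \<Rightarrow> real) \<times> real \<times> ('v \<times> 'k \<Rightarrow> real)"

fun AMNEP_feasible ::
    "('v, 'a, 'k) network \<Rightarrow> ('a \<times> 'k \<Rightarrow> real) \<Rightarrow> ('v, 'a, 'k) point \<Rightarrow> bool" where
  "AMNEP_feasible N e (x, \<mu>, \<omega>, \<pi>) \<longleftrightarrow>
    \<omega> \<ge> 0 \<and> (\<forall>p\<in>pairs N. x p \<ge> 0 \<and> \<mu> p \<ge> 0) \<and>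
    flow_conservation N x \<and>
    (\<forall>(a, k)\<in>pairs N.
      slope N k a * total_flow N x a + \<pi> (tail (graph N) a, k) - \<pi> (head (graph N) a, k)
        - \<mu> (a, k) + e (a, k) * \<omega> = - offset N k a) \<and>
    (\<forall>p\<in>pairs N. x p * \<mu> p = 0) \<and>
    (\<forall>k\<in>classes N. \<pi> (source N k, k) = 0)"

fun AMNEP_optimal ::
    "('v, 'a, 'k) network \<Rightarrow> ('a \<times> 'k \<Rightarrow> real) \<Rightarrow> ('v, 'a, 'k) point \<Rightarrow> bool" where
  "AMNEP_optimal N e (x, \<mu>, \<omega>, \<pi>) \<longleftrightarrow>
    AMNEP_feasible N e (x, \<mu>, \<omega>, \<pi>) \<and>
    (\<forall>x' \<mu>' \<omega>' \<pi>'. AMNEP_feasible N e (x', \<mu>', \<omega>', \<pi>') \<longrightarrow> \<omega> \<le> \<omega>')"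

section \<open>Matrix form\<close>

text \<open>
  Matrices are indexed by finite sets. Rows are \<^term>\<open>Inl (v, k)\<close> (flow conservation) or
  \<^term>\<open>Inr (a, k)\<close> (cost).
\<close>

datatype ('a, 'k) index = Phi_x "'a \<times> 'k" | Phi_mu "'a \<times> 'k" | Omega

definition index_set :: "('v, 'a, 'k) network \<Rightarrow> ('a, 'k) index set" where
  "index_set N = Phi_x ` pairs N \<union> Phi_mu ` pairs N \<union> {Omega}"

definition rows :: "('v, 'a, 'k) network \<Rightarrow> ('v \<times> 'k + 'a \<times> 'k) set" where
  "rows N = nonsource N <+> pairs N"

text \<open>For a loop the two contributions cancel, as they do in the flow conservation law.\<close>

fun incidence :: "('v, 'a, 'k) network \<Rightarrow> 'v \<times> 'k \<Rightarrow> 'a \<times> 'k \<Rightarrow> real" where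
  "incidence N (v, k) (a, k') =
    (if k = k'
     then of_bool (a \<in> out_arcs (class_graph N k) v) - of_bool (a \<in> in_arcs (class_graph N k) v)
     else 0)"

fun cost_matrix :: "('v, 'a, 'k) network \<Rightarrow> 'a \<times> 'k \<Rightarrow> 'a \<times> 'k \<Rightarrow> real" where
  "cost_matrix N (a, k) (a', k') = (if a = a' then slope N k a else 0)"

fun M_bar ::
    "('v, 'a, 'k) network \<Rightarrow> ('a \<times> 'k \<Rightarrow> real) \<Rightarrow> 'v \<times> 'k + 'a \<times> 'k \<Rightarrow>
     ('a, 'k) index \<Rightarrow> real" where
  "M_bar N e (Inl r) (Phi_x q) = incidence N r q"
| "M_bar N e (Inl r) (Phi_mu q) = 0"
| "M_bar N e (Inl r) Omega = 0"
| "M_bar N e (Inr p) (Phi_x q) = cost_matrix N p q"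
| "M_bar N e (Inr p) (Phi_mu q) = - of_bool (p = q)"
| "M_bar N e (Inr p) Omega = e p"

fun pi_columns ::
    "('v, 'a, 'k) network \<Rightarrow> 'v \<times> 'k + 'a \<times> 'k \<Rightarrow> 'v \<times> 'k \<Rightarrow> real" where
  "pi_columns N (Inl r) c = 0"
| "pi_columns N (Inr p) c = incidence N c p"

fun rhs :: "('v, 'a, 'k) network \<Rightarrow> 'v \<times> 'k + 'a \<times> 'k \<Rightarrow> real" where
  "rhs N (Inl (v, k)) = demand N k v"
| "rhs N (Inr (a, k)) = - offset N k a"

fun coordinate ::
    "('a \<times> 'k \<Rightarrow> real) \<Rightarrow> ('a \<times> 'k \<Rightarrow> real) \<Rightarrow> real \<Rightarrow> ('a, 'k) index \<Rightarrow> real" where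
  "coordinate x \<mu> \<omega> (Phi_x p) = x p"
| "coordinate x \<mu> \<omega> (Phi_mu p) = \<mu> p"
| "coordinate x \<mu> \<omega> Omega = \<omega>"

fun linear_constraints ::
    "('v, 'a, 'k) network \<Rightarrow> ('a \<times> 'k \<Rightarrow> real) \<Rightarrow> ('v, 'a, 'k) point \<Rightarrow> bool" where
  "linear_constraints N e (x, \<mu>, \<omega>, \<pi>) \<longleftrightarrow>
    (\<forall>r\<in>rows N.
      (\<Sum>i\<in>index_set N. M_bar N e r i * coordinate x \<mu> \<omega> i) +
      (\<Sum>c\<in>nonsource N. pi_columns N r c * \<pi> c) = rhs N r)"

section \<open>Bases\<close>

definition square_nonsingular :: "'r set \<Rightarrow> 'c set \<Rightarrow> ('r \<Rightarrow> 'c \<Rightarrow> real) \<Rightarrow> bool" where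
  "square_nonsingular R C A \<longleftrightarrow>
    card R = card C \<and>
    (\<exists>A'. (\<forall>r\<in>R. \<forall>r'\<in>R. (\<Sum>c\<in>C. A r c * A' c r') = of_bool (r = r')) \<and>
          (\<forall>c\<in>C. \<forall>c'\<in>C. (\<Sum>r\<in>R. A' c r * A r c') = of_bool (c = c')))"

definition is_basis ::
    "('v, 'a, 'k) network \<Rightarrow> ('a \<times> 'k \<Rightarrow> real) \<Rightarrow> ('a, 'k) index set \<Rightarrow> bool" where
  "is_basis N e B \<longleftrightarrow>
    B \<subseteq> index_set N \<and>
    square_nonsingular (rows N) (B <+> nonsource N)
      (\<lambda>r. case_sum (M_bar N e r) (pi_columns N r))"

text \<open>
  Points are total functions. They are required to vanish off their index sets as well, so that
  the basic solution is unique as a function. In particular \<open>\<pi>\<close> vanishes at the sources.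
\<close>

fun supported_by ::
    "('v, 'a, 'k) network \<Rightarrow> ('a, 'k) index set \<Rightarrow> ('v, 'a, 'k) point \<Rightarrow> bool" where
  "supported_by N B (x, \<mu>, \<omega>, \<pi>) \<longleftrightarrow>
    (\<forall>i. i \<notin> B \<longrightarrow> coordinate x \<mu> \<omega> i = 0) \<and> (\<forall>c. c \<notin> nonsource N \<longrightarrow> \<pi> c = 0)"

definition basic_solution ::
    "('v, 'a, 'k) network \<Rightarrow> ('a \<times> 'k \<Rightarrow> real) \<Rightarrow> ('a, 'k) index set \<Rightarrow>
     ('v, 'a, 'k) point \<Rightarrow> bool" where
  "basic_solution N e B z \<longleftrightarrow>
    linear_constraints N e z \<and> supported_by N B z \<and>
    (\<forall>z'. linear_constraints N e z' \<and> supported_by N B z' \<longrightarrow> z' = z)"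

definition feasible_basis ::
    "('v, 'a, 'k) network \<Rightarrow> ('a \<times> 'k \<Rightarrow> real) \<Rightarrow> ('a, 'k) index set \<Rightarrow> bool" where
  "feasible_basis N e B \<longleftrightarrow>
    is_basis N e B \<and>
    (\<exists>x \<mu> \<omega> \<pi>. basic_solution N e B (x, \<mu>, \<omega>, \<pi>) \<and>
      (\<forall>p\<in>pairs N. x p \<ge> 0 \<and> \<mu> p \<ge> 0) \<and> \<omega> \<ge> 0)"

definition complementary :: "('v, 'a, 'k) network \<Rightarrow> ('a, 'k) index set \<Rightarrow> bool" where
  "complementary N B \<longleftrightarrow> (\<forall>p\<in>pairs N. \<not> (Phi_x p \<in> B \<and> Phi_mu p \<in> B))"

abbreviation feasible_complementary_basis ::
    "('v, 'a, 'k) network \<Rightarrow> ('a \<times> 'k \<Rightarrow> real) \<Rightarrow> ('a, 'k) index set \<Rightarrow> bool" where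
  "feasible_complementary_basis N e B \<equiv> feasible_basis N e B \<and> complementary N B"

definition twin_indices ::
    "('v, 'a, 'k) network \<Rightarrow> ('a, 'k) index set \<Rightarrow> ('a, 'k) index set" where
  "twin_indices N B =
    (\<Union>p\<in>{p\<in>pairs N. Phi_x p \<notin> B \<and> Phi_mu p \<notin> B}. {Phi_x p, Phi_mu p})"

definition nondegenerate :: "('v, 'a, 'k) network \<Rightarrow> ('a \<times> 'k \<Rightarrow> real) \<Rightarrow> bool" where
  "nondegenerate N e \<longleftrightarrow>
    (\<forall>B x \<mu> \<omega> \<pi>. feasible_basis N e B \<and> basic_solution N e B (x, \<mu>, \<omega>, \<pi>) \<longrightarrow>
      (\<forall>p\<in>pairs N. (Phi_x p \<in> B \<longrightarrow> x p > 0) \<and> (Phi_mu p \<in> B \<longrightarrow> \<mu> p > 0)))"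

section \<open>The algorithm\<close>

fun tree_vector :: "('k \<Rightarrow> 'a set) \<Rightarrow> 'a \<times> 'k \<Rightarrow> real" where
  "tree_vector T (a, k) = (if a \<in> T k then 0 else 1)"

definition initial_set ::
    "('v, 'a, 'k) network \<Rightarrow> ('k \<Rightarrow> 'a set) \<Rightarrow> ('a, 'k) index set" where
  "initial_set N T =
    Phi_x ` {(a, k). k \<in> classes N \<and> a \<in> T k} \<union>
    Phi_mu ` {(a, k). k \<in> classes N \<and> a \<in> class_arcs N k - T k} \<union> {Omega}"

datatype ('a, 'k) config =
  Running (current: "('a, 'k) index set") (entering: "('a, 'k) index")
| Stopped "('a, 'k) index set"

definition stops_immediately :: "('v, 'a, 'k) network \<Rightarrow> ('k \<Rightarrow> 'a set) \<Rightarrow> bool" where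
  "stops_immediately N T \<longleftrightarrow>
    (let e = tree_vector T; B = initial_set N T - {Omega} in
     feasible_complementary_basis N e B \<and>
     (\<exists>x \<mu> \<pi>. basic_solution N e B (x, \<mu>, 0, \<pi>) \<and> AMNEP_optimal N e (x, \<mu>, 0, \<pi>)))"

inductive lemke_init ::
    "('v, 'a, 'k) network \<Rightarrow> ('k \<Rightarrow> 'a set) \<Rightarrow> ('a, 'k) config \<Rightarrow> bool"
  for N T where
  "stops_immediately N T \<Longrightarrow> lemke_init N T (Stopped (initial_set N T - {Omega}))"
| "\<not> stops_immediately N T \<Longrightarrow> p \<in> pairs N \<Longrightarrow> B = initial_set N T - {Phi_mu p} \<Longrightarrow>
   feasible_complementary_basis N (tree_vector T) B \<Longrightarrow>
   lemke_init N T (Running B (Phi_x p))"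

definition leaving ::
    "('v, 'a, 'k) network \<Rightarrow> ('a \<times> 'k \<Rightarrow> real) \<Rightarrow> ('a, 'k) index set \<Rightarrow>
     ('a, 'k) index \<Rightarrow> ('a, 'k) index \<Rightarrow> bool" where
  "leaving N e B i j \<longleftrightarrow>
    j \<noteq> i \<and> feasible_complementary_basis N e (B \<union> {i} - {j})"

text \<open>
  A running configuration without a unique leaving index, or whose leaving index is not a twin
  index of a new basis that has twin indices, has no successor. The algorithm is thus
  well-defined if it can only get stuck in a configuration of the form \<^term>\<open>Stopped B\<close>.
\<close>

inductive lemke_step ::
    "('v, 'a, 'k) network \<Rightarrow> ('a \<times> 'k \<Rightarrow> real) \<Rightarrow>
     ('a, 'k) config \<Rightarrow> ('a, 'k) config \<Rightarrow> bool"
  for N e where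
  "leaving N e B i j \<Longrightarrow> \<exists>!j'. leaving N e B i j' \<Longrightarrow> B' = B \<union> {i} - {j} \<Longrightarrow>
   twin_indices N B' = {} \<Longrightarrow> lemke_step N e (Running B i) (Stopped B')"
| "leaving N e B i j \<Longrightarrow> \<exists>!j'. leaving N e B i j' \<Longrightarrow> B' = B \<union> {i} - {j} \<Longrightarrow>
   twin_indices N B' = {j, i'} \<Longrightarrow> i' \<noteq> j \<Longrightarrow>
   lemke_step N e (Running B i) (Running B' i')"

section \<open>Demands that can be routed on the trees\<close>

text \<open>
  Every \<open>x\<close> supported by the starting bases of the algorithm is a flow on the trees. If the
  (unique) such flow has a negative entry, for instance if \<open>b\<close> is positive at a leaf, then there
  is no feasible starting basis, and \<open>MNEP\<close> itself may be infeasible. Demands issued by the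
  sources only can always be routed, as shown below.
\<close>

definition routable_on ::
    "('v, 'a, 'k) network \<Rightarrow> ('k \<Rightarrow> 'a set) \<Rightarrow> bool" where
  "routable_on N T \<longleftrightarrow>
    (\<exists>x. flow_conservation N x \<and>
      (\<forall>(a, k)\<in>pairs N. x (a, k) \<ge> 0 \<and> (a \<notin> T k \<longrightarrow> x (a, k) = 0)))"

lemma tree_path_flow:
  assumes G: "fin_digraph G" and T: "T \<subseteq> arcs G" and r: "r \<in> verts G"
    and reach: "(r, w) \<in> (arcs_ends (G\<lparr>arcs := T\<rparr>))\<^sup>*"
  shows "\<exists>f :: 'a \<Rightarrow> real. (\<forall>a. f a \<ge> 0) \<and> (\<forall>a. a \<notin> T \<longrightarrow> f a = 0) \<and>
    (\<forall>v. (\<Sum>a\<in>out_arcs G v. f a) - (\<Sum>a\<in>in_arcs G v. f a) = of_bool (v = r) - of_bool (v = w))"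
  using reach
proof (induction rule: rtrancl_induct)
  case base
  then show ?case by (intro exI[of _ "\<lambda>_. 0"]) auto
next
  case (step y z)
  then obtain f :: "'a \<Rightarrow> real" where f: "\<forall>a. f a \<ge> 0" "\<forall>a. a \<notin> T \<longrightarrow> f a = 0"
    "\<forall>v. (\<Sum>a\<in>out_arcs G v. f a) - (\<Sum>a\<in>in_arcs G v. f a) = of_bool (v = r) - of_bool (v = y)"
    by blast
  from step obtain a0 where a0: "a0 \<in> T" "tail G a0 = y" "head G a0 = z"
    by (auto simp: arcs_ends_conv)
  let ?g = "\<lambda>a. f a + of_bool (a = a0)"
  have fin: "finite (out_arcs G v)" "finite (in_arcs G v)" for v
    using fin_digraph.finite_out_arcs[OF G] fin_digraph.finite_in_arcs[OF G] by auto
  have o: "(\<Sum>a\<in>out_arcs G v. of_bool (a = a0)) = (of_bool (v = y) :: real)" for v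
    using a0 T fin[of v] by (auto simp: of_bool_def out_arcs_def)
  have i: "(\<Sum>a\<in>in_arcs G v. of_bool (a = a0)) = (of_bool (v = z) :: real)" for v
    using a0 T fin[of v] by (auto simp: of_bool_def in_arcs_def)
  have "(\<Sum>a\<in>out_arcs G v. ?g a) - (\<Sum>a\<in>in_arcs G v. ?g a) = of_bool (v = r) - of_bool (v = z)"
    for v
    using f(3)[rule_format, of v] unfolding sum.distrib o i by linarith
  then show ?case using f(1,2) a0(1) by (intro exI[of _ ?g]) auto
qed

lemma fin_digraph_class_graph:
  assumes "multiclass_network N"
  shows "fin_digraph (class_graph N k)"
proof -
  interpret fin_digraph "graph N" using assms by (rule multiclass_network.fin_digraph)
  have "{v. source N k \<rightarrow>\<^sup>*\<^bsub>graph N\<^esub> v} \<subseteq> verts (graph N)"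
    by (auto intro: reachable_in_verts)
  moreover have "source N k \<rightarrow>\<^sup>*\<^bsub>graph N\<^esub> head (graph N) a"
    if "a \<in> arcs (graph N)" "source N k \<rightarrow>\<^sup>*\<^bsub>graph N\<^esub> tail (graph N) a" for a
    using that by (meson in_arcs_imp_in_arcs_ends reachable_adj_trans)
  ultimately show ?thesis
    by unfold_locales (auto simp: class_graph_def Let_def intro: finite_subset)
qed

lemma routable_onI:
  assumes N: "multiclass_network N"
    and T: "\<And>k. k \<in> classes N \<Longrightarrow> arborescence (class_graph N k) (source N k) (T k)"
    and b: "\<And>k v. (v, k) \<in> nonsource N \<Longrightarrow> demand N k v \<le> 0"
  shows "routable_on N T"
proof -
  interpret multiclass_network N by (rule N)
  have "\<exists>x :: 'b \<Rightarrow> real. (\<forall>a. x a \<ge> 0) \<and> (\<forall>a. a \<notin> T k \<longrightarrow> x a = 0) \<and>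
      (\<forall>v\<in>class_verts N k. (\<Sum>a\<in>out_arcs (class_graph N k) v. x a) =
         (\<Sum>a\<in>in_arcs (class_graph N k) v. x a) + demand N k v)" if k: "k \<in> classes N" for k
  proof -
    let ?G = "class_graph N k" and ?s = "source N k"
    let ?W = "verts ?G - {?s}"
    interpret G: fin_digraph ?G by (rule fin_digraph_class_graph[OF N])
    have s: "?s \<in> verts ?G"
      using source_in_verts[OF k] wf_digraph.reachable_refl[of "graph N"] fin_digraph
      by (auto simp: class_graph_def Let_def fin_digraph_def)
    have TG: "T k \<subseteq> arcs ?G"
      using T[OF k] by (auto simp: arborescence_def spanning_def subgraph_def)
    have "\<exists>f :: 'b \<Rightarrow> real. (\<forall>a. f a \<ge> 0) \<and> (\<forall>a. a \<notin> T k \<longrightarrow> f a = 0) \<and>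
      (\<forall>v. (\<Sum>a\<in>out_arcs ?G v. f a) - (\<Sum>a\<in>in_arcs ?G v. f a) = of_bool (v = ?s) - of_bool (v = w))"
      if "w \<in> verts ?G" for w
      using T[OF k] that
      by (intro tree_path_flow[OF G.fin_digraph TG s] reachable_rtranclI)
         (auto simp: arborescence_def)
    then obtain f :: "'a \<Rightarrow> 'b \<Rightarrow> real" where f:
      "\<And>w a. w \<in> verts ?G \<Longrightarrow> f w a \<ge> 0" "\<And>w a. w \<in> verts ?G \<Longrightarrow> a \<notin> T k \<Longrightarrow> f w a = 0"
      "\<And>w v. w \<in> verts ?G \<Longrightarrow> (\<Sum>a\<in>out_arcs ?G v. f w a) - (\<Sum>a\<in>in_arcs ?G v. f w a) =
        of_bool (v = ?s) - of_bool (v = w)"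
      by metis
    define x where "x a = (\<Sum>w\<in>?W. - demand N k w * f w a)" for a
    have "x a \<ge> 0" for a
      unfolding x_def using f(1) b k
      by (intro sum_nonneg mult_nonneg_nonneg) (auto simp: nonsource_def)
    moreover have "x a = 0" if "a \<notin> T k" for a
      unfolding x_def using f(2) that by (intro sum.neutral) auto
    moreover have "(\<Sum>a\<in>out_arcs ?G v. x a) = (\<Sum>a\<in>in_arcs ?G v. x a) + demand N k v"
      if v: "v \<in> verts ?G" for v
    proof -
      have swap: "(\<Sum>a\<in>S. x a) = (\<Sum>w\<in>?W. - demand N k w * (\<Sum>a\<in>S. f w a))" for S
        unfolding x_def sum_distrib_left by (rule sum.swap)
      have "(\<Sum>a\<in>out_arcs ?G v. x a) - (\<Sum>a\<in>in_arcs ?G v. x a) =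
          (\<Sum>w\<in>?W. - demand N k w *
            ((\<Sum>a\<in>out_arcs ?G v. f w a) - (\<Sum>a\<in>in_arcs ?G v. f w a)))"
        unfolding swap sum_subtractf[symmetric] by (simp add: right_diff_distrib)
      also have "\<dots> = (\<Sum>w\<in>?W. - demand N k w * (of_bool (v = ?s) - of_bool (v = w)))"
        by (intro sum.cong) (auto simp: f(3))
      also have "\<dots> = demand N k v"
      proof (cases "v = ?s")
        case True
        have "(\<Sum>w\<in>?W. - demand N k w * (of_bool (v = ?s) - of_bool (v = w))) =
            - (\<Sum>w\<in>?W. demand N k w)"
          unfolding sum_negf[symmetric] by (intro sum.cong) (use True in auto)
        also have "\<dots> = demand N k v"
          using demand_sum[OF k] sum.remove[OF G.finite_verts s, of "demand N k"] True by simp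
        finally show ?thesis .
      next
        case False
        have "(\<Sum>w\<in>?W. - demand N k w * (of_bool (v = ?s) - of_bool (v = w))) =
            (\<Sum>w\<in>?W. if v = w then demand N k w else 0)"
          by (intro sum.cong) (use False in auto)
        then show ?thesis using False v by simp
      qed
      finally show ?thesis by simp
    qed
    ultimately show ?thesis by blast
  qed
  then obtain x where x: "\<forall>k\<in>classes N. (\<forall>a. (x k a :: real) \<ge> 0) \<and>
      (\<forall>a. a \<notin> T k \<longrightarrow> x k a = 0) \<and>
      (\<forall>v\<in>class_verts N k. (\<Sum>a\<in>out_arcs (class_graph N k) v. x k a) =
         (\<Sum>a\<in>in_arcs (class_graph N k) v. x k a) + demand N k v)"
    by (metis (no_types, lifting))
  show ?thesis
    unfolding routable_on_def flow_conservation_def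
    by (rule exI[of _ "\<lambda>(a, k). x k a"]) (use x in \<open>auto simp: pairs_def\<close>)
qed

end

theory Submission
  imports Defs
begin

text \<open>
  Lemke's argument. Nondegeneracy makes every pivot unique and reversible, so the states
  (basis, entering twin) reached from the starting basis form a path that never revisits a state.
  It can only end at a basis without \<open>\<omega>\<close> or on a ray. A ray has no flow, since the costs increase
  strictly; comparing the current flow with the tree flow, which is positive by nondegeneracy,
  shows that its \<open>\<mu>\<close> vanishes on the trees, hence so do its potentials. Therefore the only ray is the
  one that raises \<open>\<omega>\<close> from the starting basis, and a reversible path never returns to its start.
\<close>

section \<open>Square systems and pivots\<close>

text \<open>Two features of the program shape the argument. Non-degeneracy makes the basic entries
  of \<open>x\<close> and \<open>\<mu>\<close> positive but says nothing about
  \<open>\<omega>\<close>, so the pivoting theory has to allow one exempt index; uniqueness survives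
  because at most one of two tied leaving candidates can be \<open>\<omega>\<close>. Moreover, the
  start and its reverse share a basis and differ only in the twin that enters:
  \<open>Phi_x p0\<close> begins the algorithm, whereas \<open>Phi_mu p0\<close> lets
  \<open>\<omega>\<close> grow for ever. As these are different states, the absence of repetitions
  would not by itself keep a run from ending in the reversed start; a parity argument does.

  The vector \<open>e\<close> is 1 off the trees, so that raising \<open>\<omega>\<close> repairs
  every negative \<open>\<mu>\<close> there. It is 0 on the trees, where \<open>x\<close> is basic
  instead of \<open>\<mu>\<close>, so that raising \<open>\<omega>\<close> disturbs neither the tree
  flow nor the potentials.\<close>

lemma exists_kernel_vector:
  fixes A :: "'r \<Rightarrow> 'c \<Rightarrow> real"
  assumes "finite R" "finite C" "card R < card C"
  shows "\<exists>w. (\<forall>r\<in>R. (\<Sum>c\<in>C. A r c * w c) = 0) \<and> (\<exists>c\<in>C. w c \<noteq> 0)"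
  using assms
proof (induction R arbitrary: A C rule: finite_induct)
  case empty
  then have "C \<noteq> {}" by auto
  then show ?case by (intro exI[of _ "\<lambda>_. 1"]) auto
next
  case (insert r R)
  show ?case
  proof (cases "\<forall>c\<in>C. A r c = 0")
    case True
    obtain w where "\<forall>r\<in>R. (\<Sum>c\<in>C. A r c * w c) = 0" "\<exists>c\<in>C. w c \<noteq> 0"
      using insert.IH[of C A] insert.prems insert.hyps by auto
    then show ?thesis using True by (intro exI[of _ w]) auto
  next
    case False
    then obtain c0 where c0: "c0 \<in> C" "A r c0 \<noteq> 0" by auto
    let ?C = "C - {c0}"
    \<comment> \<open>Gaussian elimination: row \<open>r\<close> clears column \<open>c0\<close>
      from the other rows.\<close>
    define A2 where "A2 r' c = A r' c - A r' c0 / A r c0 * A r c" for r' c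
    have "card R < card ?C" using insert.prems insert.hyps c0 by auto
    then obtain w where w: "\<forall>r\<in>R. (\<Sum>c\<in>?C. A2 r c * w c) = 0" "\<exists>c\<in>?C. w c \<noteq> 0"
      using insert.IH[of ?C A2] insert.prems by auto
    define s where "s = (\<Sum>c\<in>?C. A r c * w c)"
    \<comment> \<open>Back substitution: this is the only value at \<open>c0\<close> that satisfies
      row \<open>r\<close>.\<close>
    define w' where "w' = w(c0 := - s / A r c0)"
    have split: "(\<Sum>c\<in>C. A r' c * w' c) = A r' c0 * (- s / A r c0) + (\<Sum>c\<in>?C. A r' c * w c)" for r'
    proof -
      have "(\<Sum>c\<in>C. A r' c * w' c) = A r' c0 * w' c0 + (\<Sum>c\<in>?C. A r' c * w' c)"
        using c0 insert.prems by (simp add: sum.remove)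
      also have "(\<Sum>c\<in>?C. A r' c * w' c) = (\<Sum>c\<in>?C. A r' c * w c)"
        by (intro sum.cong) (auto simp: w'_def)
      finally show ?thesis by (simp add: w'_def)
    qed
    have "(\<Sum>c\<in>C. A r' c * w' c) = 0" if "r' \<in> R" for r'
    proof -
      have "0 = (\<Sum>c\<in>?C. A r' c * w c - A r' c0 / A r c0 * (A r c * w c))"
        using w(1) that by (simp add: A2_def algebra_simps)
      also have "\<dots> = (\<Sum>c\<in>?C. A r' c * w c) - A r' c0 / A r c0 * s"
        by (simp add: sum_subtractf sum_distrib_left s_def)
      finally show ?thesis unfolding split by simp
    qed
    moreover have "(\<Sum>c\<in>C. A r c * w' c) = 0"
      unfolding split using c0 by (simp add: s_def)
    moreover have "\<exists>c\<in>C. w' c \<noteq> 0" using w(2) by (auto simp: w'_def)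
    ultimately show ?thesis by auto
  qed
qed

text \<open>Nonsingularity is defined by a two-sided inverse, while all later arguments show a
  trivial kernel. Solving for the unit vectors gives a right inverse, and the trivial kernel turns
  it into a left inverse.\<close>

lemma square_nonsingularI:
  fixes A :: "'r \<Rightarrow> 'c \<Rightarrow> real"
  assumes fin: "finite R" "finite C" and card: "card R = card C"
    and ker: "\<And>w. (\<And>r. r \<in> R \<Longrightarrow> (\<Sum>c\<in>C. A r c * w c) = 0) \<Longrightarrow> \<forall>c\<in>C. w c = 0"
  shows "square_nonsingular R C A"
proof -
  have "\<exists>w. \<forall>r\<in>R. (\<Sum>c\<in>C. A r c * w c) = g r" for g
  proof -
    \<comment> \<open>With \<open>g\<close> appended as the column \<open>None\<close> there are
      more columns than rows, hence a kernel vector. Its entry at \<open>None\<close> is nonzero,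
      since the kernel of \<open>A\<close> is trivial, and dividing by it solves the system.\<close>
    define A2 where "A2 r c = (case c of None \<Rightarrow> g r | Some c \<Rightarrow> A r c)" for r c
    have "card (insert None (Some ` C)) = Suc (card C)"
      using fin by (simp add: card_image)
    then obtain w where w: "\<forall>r\<in>R. (\<Sum>c\<in>insert None (Some ` C). A2 r c * w c) = 0"
      "\<exists>c\<in>insert None (Some ` C). w c \<noteq> 0"
      using exists_kernel_vector[of R "insert None (Some ` C)" A2] fin card by auto
    have eq: "g r * w None + (\<Sum>c\<in>C. A r c * w (Some c)) = 0" if "r \<in> R" for r
      using w(1) that fin by (simp add: A2_def sum.reindex)
    have "w None \<noteq> 0"
    proof
      assume 0: "w None = 0"
      then have "\<forall>c\<in>C. w (Some c) = 0" using eq by (intro ker) auto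
      with w(2) 0 show False by auto
    qed
    then have "(\<Sum>c\<in>C. A r c * (- w (Some c) / w None)) = g r" if "r \<in> R" for r
    proof -
      have "(\<Sum>c\<in>C. A r c * (- w (Some c) / w None)) = - (\<Sum>c\<in>C. A r c * w (Some c)) / w None"
        by (simp add: sum_negf sum_divide_distrib)
      also have "\<dots> = g r * w None / w None" using eq[OF that] by (simp add: add_eq_0_iff)
      finally show ?thesis using \<open>w None \<noteq> 0\<close> by simp
    qed
    then show ?thesis by (intro exI[of _ "\<lambda>c. - w (Some c) / w None"]) auto
  qed
  then obtain sol where sol: "\<forall>g. \<forall>r\<in>R. (\<Sum>c\<in>C. A r c * sol g c) = g r" by metis
  define W where "W r' = sol (\<lambda>r. of_bool (r = r'))" for r'
  have W: "(\<Sum>c\<in>C. A r c * W r' c) = of_bool (r = r')" if "r \<in> R" for r r'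
    using sol[rule_format, OF that] by (simp add: W_def)
  have "(\<Sum>r\<in>R. W r c * A r c') = of_bool (c = c')" if c: "c \<in> C" "c' \<in> C" for c c'
  proof -
    \<comment> \<open>A column of (right inverse times \<open>A\<close>) minus the identity;
      \<open>A\<close> annihilates it.\<close>
    define w where "w c = (\<Sum>r\<in>R. W r c * A r c') - of_bool (c = c')" for c
    have "(\<Sum>c\<in>C. A r c * w c) = 0" if r: "r \<in> R" for r
    proof -
      have "(\<Sum>c\<in>C. A r c * w c) =
          (\<Sum>c\<in>C. \<Sum>r'\<in>R. A r c * W r' c * A r' c') - (\<Sum>c\<in>C. A r c * of_bool (c = c'))"
        unfolding w_def right_diff_distrib sum_subtractf by (simp add: sum_distrib_left mult.assoc)
      also have "(\<Sum>c\<in>C. \<Sum>r'\<in>R. A r c * W r' c * A r' c') =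
          (\<Sum>r'\<in>R. (\<Sum>c\<in>C. A r c * W r' c) * A r' c')"
        by (subst sum.swap) (simp add: sum_distrib_right)
      also have "\<dots> = (\<Sum>r'\<in>R. if r = r' then A r' c' else 0)"
        using W[OF r] by (intro sum.cong) auto
      also have "\<dots> = A r c'" using r fin by simp
      also have "(\<Sum>c\<in>C. A r c * of_bool (c = c')) = (\<Sum>c\<in>C. if c = c' then A r c else 0)"
        by (intro sum.cong) auto
      also have "\<dots> = A r c'" using c fin by simp
      finally show ?thesis by simp
    qed
    then have "w c = 0" using ker c by blast
    then show ?thesis by (simp add: w_def)
  qed
  then show ?thesis
    unfolding square_nonsingular_def using card W
    by (intro conjI exI[of _ "\<lambda>c r. W r c"]) auto
qed

lemma square_nonsingular_kernel:
  assumes "finite R" "finite C" "square_nonsingular R C A"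
    and "\<And>r. r \<in> R \<Longrightarrow> (\<Sum>c\<in>C. A r c * w c) = 0" and c: "c \<in> C"
  shows "w c = 0"
proof -
  obtain A' where A': "\<And>c c'. c \<in> C \<Longrightarrow> c' \<in> C \<Longrightarrow> (\<Sum>r\<in>R. A' c r * A r c') = of_bool (c = c')"
    using assms(3) unfolding square_nonsingular_def by blast
  have "0 = (\<Sum>r\<in>R. A' c r * (\<Sum>c'\<in>C. A r c' * w c'))" using assms(4) by simp
  also have "\<dots> = (\<Sum>c'\<in>C. (\<Sum>r\<in>R. A' c r * A r c') * w c')"
    unfolding sum_distrib_left sum_distrib_right by (subst sum.swap) (simp add: mult.assoc)
  also have "\<dots> = (\<Sum>c'\<in>C. if c = c' then w c' else 0)"
    using A' c by (intro sum.cong) auto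
  also have "\<dots> = w c" using c assms(2) by simp
  finally show ?thesis by simp
qed

lemma square_nonsingular_solve:
  assumes "finite R" "square_nonsingular R C A"
  obtains w where "\<And>r. r \<in> R \<Longrightarrow> (\<Sum>c\<in>C. A r c * w c) = g r"
proof -
  obtain A' where A': "\<And>r r'. r \<in> R \<Longrightarrow> r' \<in> R \<Longrightarrow> (\<Sum>c\<in>C. A r c * A' c r') = of_bool (r = r')"
    using assms(2) unfolding square_nonsingular_def by blast
  have "(\<Sum>c\<in>C. A r c * (\<Sum>r'\<in>R. A' c r' * g r')) = g r" if r: "r \<in> R" for r
  proof -
    have "(\<Sum>c\<in>C. A r c * (\<Sum>r'\<in>R. A' c r' * g r')) =
        (\<Sum>r'\<in>R. (\<Sum>c\<in>C. A r c * A' c r') * g r')"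
      unfolding sum_distrib_left sum_distrib_right by (subst sum.swap) (simp add: mult.assoc)
    also have "\<dots> = (\<Sum>r'\<in>R. if r = r' then g r' else 0)"
      using A' r by (intro sum.cong) auto
    finally show ?thesis using r assms(1) by simp
  qed
  then show ?thesis by (rule that)
qed

text \<open>The columns \<open>I\<close> are sign-constrained and may enter or leave. The columns
  \<open>F\<close>, later the potentials, have either sign and belong to every basis.\<close>

locale simplex_tableau =
  fixes R :: "'r set" and I :: "'i set" and F :: "'f set"
    and A :: "'r \<Rightarrow> 'i + 'f \<Rightarrow> real" and g :: "'r \<Rightarrow> real"
  assumes finite_R: "finite R" and finite_I: "finite I" and finite_F: "finite F"
begin

definition basis :: "'i set \<Rightarrow> bool" where
  "basis B \<longleftrightarrow> B \<subseteq> I \<and> square_nonsingular R (B <+> F) A"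

definition solves :: "('r \<Rightarrow> real) \<Rightarrow> 'i set \<Rightarrow> ('i + 'f \<Rightarrow> real) \<Rightarrow> bool" where
  "solves h B w \<longleftrightarrow> (\<forall>r\<in>R. (\<Sum>c\<in>I <+> F. A r c * w c) = h r) \<and>
    (\<forall>i. i \<notin> B \<longrightarrow> w (Inl i) = 0) \<and> (\<forall>f. f \<notin> F \<longrightarrow> w (Inr f) = 0)"

definition feasible :: "'i set \<Rightarrow> bool" where
  "feasible B \<longleftrightarrow> basis B \<and> (\<exists>w. solves g B w \<and> (\<forall>i\<in>I. w (Inl i) \<ge> 0))"

lemma solves_off: "solves h B w \<Longrightarrow> c \<notin> B <+> F \<Longrightarrow> w c = 0"
  by (cases c) (auto simp: solves_def)

lemma finite_cols: "B \<subseteq> I \<Longrightarrow> finite (B <+> F)"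
  using finite_I finite_F by (auto intro: finite_subset)

lemma basisD: "basis B \<Longrightarrow> B \<subseteq> I" "basis B \<Longrightarrow> finite B"
  using finite_I by (auto simp: basis_def intro: finite_subset)

lemma sum_cols:
  assumes "B \<subseteq> I" "\<And>c. c \<notin> B <+> F \<Longrightarrow> w c = 0"
  shows "(\<Sum>c\<in>I <+> F. A r c * w c) = (\<Sum>c\<in>B <+> F. A r c * w c)"
  using assms finite_cols[of I] by (intro sum.mono_neutral_right) auto

lemma basis_card:
  assumes "basis B"
  shows "card B + card F = card R"
  using assms card_Plus[OF basisD(2)[OF assms] finite_F]
  by (simp add: basis_def square_nonsingular_def)

lemma solves_zero_unique:
  assumes "basis B" "solves (\<lambda>_. 0) B w"
  shows "w = (\<lambda>_. 0)"
proof
  fix c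
  show "w c = 0"
  proof (cases "c \<in> B <+> F")
    case True
    then show ?thesis
      using assms sum_cols[of B w] solves_off[OF assms(2)]
      by (intro square_nonsingular_kernel[OF finite_R finite_cols[OF basisD(1)], of B A w])
        (simp_all add: basis_def solves_def)
  qed (rule solves_off[OF assms(2)])
qed

lemma solves_add:
  assumes "solves h B v" "solves h' B w"
  shows "solves (\<lambda>r. h r + t * h' r) B (\<lambda>c. v c + t * w c)"
proof -
  have eq: "(\<Sum>c\<in>I <+> F. A r c * (v c + t * w c)) =
      (\<Sum>c\<in>I <+> F. A r c * v c) + t * (\<Sum>c\<in>I <+> F. A r c * w c)" for r
    unfolding sum_distrib_left sum.distrib[symmetric] by (intro sum.cong) (auto simp: algebra_simps)
  show ?thesis
    using assms unfolding solves_def eq by simp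
qed

lemma solves_mono: "solves h B w \<Longrightarrow> B \<subseteq> B' \<Longrightarrow> solves h B' w"
  by (auto simp: solves_def)

lemma solves_unique:
  assumes "basis B" "solves h B v" "solves h B w"
  shows "v = w"
proof
  fix c
  have "solves (\<lambda>_. 0) B (\<lambda>c. v c + (-1) * w c)"
    using solves_add[OF assms(2,3), of "-1"] by simp
  then have "(\<lambda>c. v c + (-1) * w c) = (\<lambda>_. 0)" by (rule solves_zero_unique[OF assms(1)])
  from fun_cong[OF this, of c] show "v c = w c" by simp
qed

lemma basisI:
  assumes "B \<subseteq> I" "card B + card F = card R" "\<And>w. solves (\<lambda>_. 0) B w \<Longrightarrow> w = (\<lambda>_. 0)"
  shows "basis B"
  unfolding basis_def
proof (intro conjI square_nonsingularI)
  show "card R = card (B <+> F)"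
    using assms(2) card_Plus[OF finite_subset[OF assms(1) finite_I] finite_F] by simp
  fix w assume w: "\<And>r. r \<in> R \<Longrightarrow> (\<Sum>c\<in>B <+> F. A r c * w c) = 0"
  let ?w = "\<lambda>c. if c \<in> B <+> F then w c else 0"
  have "(\<Sum>c\<in>I <+> F. A r c * ?w c) = (\<Sum>c\<in>B <+> F. A r c * w c)" for r
    by (subst sum_cols[OF assms(1)]) (auto intro: sum.cong)
  then have "?w = (\<lambda>_. 0)" using w by (intro assms(3)) (auto simp: solves_def)
  then show "\<forall>c\<in>B <+> F. w c = 0" by (metis (full_types))
qed (use assms finite_R finite_cols in auto)

lemma exists_solves:
  assumes "basis B"
  obtains w where "solves h B w"
proof -
  obtain w where w: "\<And>r. r \<in> R \<Longrightarrow> (\<Sum>c\<in>B <+> F. A r c * w c) = h r"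
    using square_nonsingular_solve[OF finite_R, of "B <+> F" A h] assms by (auto simp: basis_def)
  let ?w = "\<lambda>c. if c \<in> B <+> F then w c else 0"
  have "(\<Sum>c\<in>I <+> F. A r c * ?w c) = (\<Sum>c\<in>B <+> F. A r c * w c)" for r
    using assms by (subst sum_cols[of B]) (auto simp: basis_def intro: sum.cong)
  then show ?thesis using w by (intro that[of ?w]) (auto simp: solves_def)
qed

text \<open>The edge direction of the simplex method. With the entry of \<open>i\<close> normalised
  to 1, the step length is the new value of \<open>i\<close>.\<close>

definition direction :: "'i set \<Rightarrow> 'i \<Rightarrow> ('i + 'f \<Rightarrow> real) \<Rightarrow> bool" where
  "direction B i d \<longleftrightarrow> solves (\<lambda>_. 0) (insert i B) d \<and> d (Inl i) = 1"

lemma exists_direction: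
  assumes "basis B" "i \<in> I" "i \<notin> B"
  obtains d where "direction B i d"
proof -
  obtain w where w: "solves (\<lambda>r. - A r (Inl i)) B w" using exists_solves[OF assms(1)] .
  define d where "d c = w c + of_bool (c = Inl i)" for c
  have "(\<Sum>c\<in>I <+> F. A r c * d c) = (\<Sum>c\<in>I <+> F. A r c * w c) + A r (Inl i)" for r
  proof -
    have "(\<Sum>c\<in>I <+> F. A r c * d c) =
        (\<Sum>c\<in>I <+> F. A r c * w c) + (\<Sum>c\<in>I <+> F. if c = Inl i then A r c else 0)"
      unfolding sum.distrib[symmetric] by (intro sum.cong) (auto simp: d_def algebra_simps)
    then show ?thesis using assms(2) finite_cols[of I] by (simp add: InlI)
  qed
  moreover have "w (Inl i) = 0" using w assms(3) by (auto simp: solves_def)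
  ultimately have "direction B i d"
    using w by (auto simp: direction_def solves_def d_def)
  then show ?thesis by (rule that)
qed

lemma solves_add_direction:
  assumes "solves h (insert i B) w" "direction B i d"
  shows "solves h (insert i B) (\<lambda>c. w c + t * d c)"
  using solves_add[OF assms(1), of "\<lambda>_. 0" d t] assms(2) by (simp add: direction_def)

lemma solves_cancel_direction:
  assumes w: "solves h (insert i B) w" and d: "direction B i d"
  shows "solves h B (\<lambda>c. w c + (- w (Inl i)) * d c)"
proof -
  let ?v = "\<lambda>c. w c + (- w (Inl i)) * d c"
  have "?v (Inl k) = 0" if "k \<notin> B" for k
    using w d that by (cases "k = i") (simp_all add: solves_def direction_def)
  then show ?thesis using solves_add_direction[OF w d, of "- w (Inl i)"] by (simp add: solves_def)
qed

text \<open>Subtracting its \<open>i\<close>-entry times \<open>d\<close> from a kernel vector of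
  the new columns leaves a kernel vector of \<open>B\<close>, which is zero. So the vector is a
  multiple of \<open>d\<close>, and the multiple is zero because the vector vanishes at
  \<open>j\<close> and \<open>d\<close> does not.\<close>

lemma basis_pivot:
  assumes B: "basis B" "i \<in> I" "i \<notin> B" and d: "direction B i d" and j: "j \<in> B" "d (Inl j) \<noteq> 0"
  shows "basis (B \<union> {i} - {j})"
proof (rule basisI)
  have "card (B \<union> {i} - {j}) = card B"
    using B(3) j(1) basisD(2)[OF B(1)] card_gt_0_iff[of B] by auto
  then show "card (B \<union> {i} - {j}) + card F = card R" using basis_card[OF B(1)] by simp
  fix w assume w: "solves (\<lambda>_. 0) (B \<union> {i} - {j}) w"
  have "solves (\<lambda>_. 0) B (\<lambda>c. w c + (- w (Inl i)) * d c)"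
    using w by (intro solves_cancel_direction[OF _ d] solves_mono[OF w]) auto
  then have "(\<lambda>c. w c + (- w (Inl i)) * d c) = (\<lambda>_. 0)" by (rule solves_zero_unique[OF B(1)])
  then have eq: "w c = w (Inl i) * d c" for c by (drule_tac fun_cong[of _ _ c]) simp
  have "w (Inl j) = 0" using w by (auto simp: solves_def)
  then have "w (Inl i) = 0" using eq[of "Inl j"] j by auto
  then show "w = (\<lambda>_. 0)" using eq by (intro ext) (metis mult_zero_left)
qed (use assms in \<open>auto simp: basis_def\<close>)

text \<open>All bases have the same cardinality, so something must leave when \<open>i\<close>
  enters.\<close>

lemma leaving_in:
  assumes B: "basis B" "i \<notin> B" "basis (B \<union> {i} - {j})" and "j \<noteq> i"
  shows "j \<in> B"
proof (rule ccontr)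
  assume "j \<notin> B"
  then have "card (B \<union> {i} - {j}) = Suc (card B)"
    using assms(2,4) basisD(2)[OF B(1)] by simp
  then show False using basis_card[OF B(1)] basis_card[OF B(3)] by simp
qed

text \<open>The solutions on the columns of \<open>B\<close> and \<open>i\<close> form the line
  through \<open>w\<close> along \<open>d\<close>. If \<open>d\<close> vanished at \<open>j\<close>,
  it would be a nonzero kernel vector of the new basis.\<close>

lemma pivot_solution:
  assumes B: "basis B" "i \<notin> B" "solves g B w" and d: "direction B i d"
    and B': "basis (B \<union> {i} - {j})" "solves g (B \<union> {i} - {j}) w'" and "j \<noteq> i"
  shows "w' c = w c + w' (Inl i) * d c" "d (Inl j) \<noteq> 0"
proof -
  have "solves g B (\<lambda>c. w' c + (- w' (Inl i)) * d c)"
    using B'(2) by (intro solves_cancel_direction[OF _ d] solves_mono[OF B'(2)]) auto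
  then have "(\<lambda>c. w' c + (- w' (Inl i)) * d c) = w" using B solves_unique by blast
  from fun_cong[OF this, of c] show "w' c = w c + w' (Inl i) * d c" by simp
  show "d (Inl j) \<noteq> 0"
  proof
    assume "d (Inl j) = 0"
    then have "solves (\<lambda>_. 0) (B \<union> {i} - {j}) d" using d by (auto simp: direction_def solves_def)
    then have "d = (\<lambda>_. 0)" using B' solves_zero_unique by blast
    then show False using d by (simp add: direction_def)
  qed
qed

lemma direction_neg_in:
  assumes "direction B i d" "d (Inl k) < 0"
  shows "k \<in> B"
  using assms by (cases "k = i") (force simp: direction_def solves_def)+

text \<open>Minimum ratio rule: an index that reaches zero first along \<open>d\<close> leaves. The
  negative entry guarantees that some index does reach zero.\<close>

lemma ratio_test:
  assumes B: "feasible B" "i \<in> I" "i \<notin> B" and d: "direction B i d"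
    and neg: "k \<in> I" "d (Inl k) < 0"
  shows "\<exists>j\<in>B. feasible (B \<union> {i} - {j})"
proof -
  obtain w where w: "solves g B w" "\<And>i. i \<in> I \<Longrightarrow> w (Inl i) \<ge> 0"
    using B by (auto simp: feasible_def)
  let ?J = "{j\<in>B. d (Inl j) < 0}"
  let ?r = "\<lambda>j. w (Inl j) / - d (Inl j)"
  have BI: "B \<subseteq> I" using B by (auto simp: feasible_def basis_def)
  have fin: "finite ?J" using finite_subset[OF BI finite_I] by simp
  have "k \<in> ?J" using neg direction_neg_in[OF d] by simp
  then obtain j where j: "j \<in> ?J" "\<And>k. k \<in> ?J \<Longrightarrow> ?r j \<le> ?r k"
    using arg_min_if_finite(1)[OF fin, of ?r] arg_min_least[OF fin, of _ ?r] by blast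
  define t where "t = ?r j"
  have t: "t \<ge> 0" using j(1) w(2) BI by (auto simp: t_def divide_nonneg_neg)
  let ?w = "\<lambda>c. w c + t * d c"
  have "solves g (insert i B) ?w"
    by (intro solves_add_direction[OF _ d] solves_mono[OF w(1)]) auto
  moreover have "?w (Inl j) = 0" using j(1) by (simp add: t_def field_simps)
  ultimately have "solves g (B \<union> {i} - {j}) ?w" by (auto simp: solves_def)
  moreover have "?w (Inl k) \<ge> 0" if k: "k \<in> I" for k
  proof (cases "d (Inl k) < 0")
    case True
    then have "k \<in> ?J" using direction_neg_in[OF d] by simp
    then have "t \<le> w (Inl k) / - d (Inl k)" using j(2) by (simp add: t_def)
    then show ?thesis using True by (simp add: field_simps)
  next
    case False
    then show ?thesis using w(2) k t by simp
  qed
  moreover have "basis (B \<union> {i} - {j})"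
    using B d j(1) by (intro basis_pivot) (auto simp: feasible_def)
  ultimately show ?thesis using j(1) by (auto simp: feasible_def)
qed

end

text \<open>\<open>free\<close> is the index exempt from positivity; it will be
  \<open>Omega\<close>.\<close>

locale nondegenerate_tableau = simplex_tableau +
  fixes free :: 'b
  assumes nondegenerate: "feasible B \<Longrightarrow> solves g B w \<Longrightarrow> i \<in> B \<Longrightarrow> i \<noteq> free \<Longrightarrow> w (Inl i) > 0"
begin

text \<open>Converse of the ratio test. The length \<open>t\<close> is the value of \<open>i\<close>
  in the new solution, positive since \<open>i\<close> is basic there and not \<open>free\<close>.
  As the entry at \<open>j\<close> goes from a nonnegative value to zero, \<open>d\<close> must be
  negative at \<open>j\<close>.\<close>

lemma leaving_step_length:
  assumes B: "feasible B" "i \<notin> B" "i \<noteq> free" "solves g B w" and d: "direction B i d"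
    and j: "j \<noteq> i" "feasible (B \<union> {i} - {j})"
  obtains t where "t > 0" "d (Inl j) < 0" "t = w (Inl j) / - d (Inl j)"
    "solves g (B \<union> {i} - {j}) (\<lambda>c. w c + t * d c)" "\<And>k. k \<in> I \<Longrightarrow> w (Inl k) + t * d (Inl k) \<ge> 0"
proof -
  obtain w' where w': "solves g (B \<union> {i} - {j}) w'" "\<And>i. i \<in> I \<Longrightarrow> w' (Inl i) \<ge> 0"
    using j by (auto simp: feasible_def)
  define t where "t = w' (Inl i)"
  have t: "t > 0" using nondegenerate[OF j(2) w'(1), of i] B j by (simp add: t_def)
  have bases: "basis B" "basis (B \<union> {i} - {j})" using B(1) j(2) by (simp_all add: feasible_def)
  note pivot = pivot_solution[OF bases(1) B(2,4) d bases(2) w'(1) j(1)]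
  have eq: "w' = (\<lambda>c. w c + t * d c)" unfolding t_def by (rule ext) (rule pivot(1))
  have dj: "d (Inl j) \<noteq> 0" by (rule pivot(2))
  have "j \<in> I" using leaving_in[OF bases(1) B(2) bases(2) j(1)] basisD(1)[OF bases(1)] by auto
  then have "w (Inl j) \<ge> 0"
    using solves_unique[OF bases(1) B(4)] B(1) unfolding feasible_def by metis
  moreover have "w (Inl j) + t * d (Inl j) = 0"
    using w'(1) eq by (auto simp: solves_def)
  ultimately have "t * d (Inl j) \<le> 0" by linarith
  then have "d (Inl j) < 0" using t dj by (auto simp: mult_le_0_iff)
  moreover have "t = w (Inl j) / - d (Inl j)"
    using \<open>w (Inl j) + t * d (Inl j) = 0\<close> dj by (simp add: field_simps)
  ultimately show ?thesis using that[of t] t w' eq by auto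
qed

text \<open>Two candidates have the same step length, so both entries vanish at the common endpoint.
  Each candidate is still basic after the other has left, and one of them is not
  \<open>free\<close>, so its entry ought to be positive.\<close>

lemma leaving_unique:
  assumes B: "feasible B" "i \<in> I" "i \<notin> B" "i \<noteq> free"
    and j: "j \<noteq> i" "feasible (B \<union> {i} - {j})" and j': "j' \<noteq> i" "feasible (B \<union> {i} - {j'})"
  shows "j = j'"
proof (rule ccontr)
  assume ne: "j \<noteq> j'"
  obtain w where w: "solves g B w" using B by (auto simp: feasible_def)
  obtain d where d: "direction B i d" using exists_direction B by (auto simp: feasible_def)
  obtain t where t: "t > 0" "d (Inl j) < 0" "t = w (Inl j) / - d (Inl j)"
    "solves g (B \<union> {i} - {j}) (\<lambda>c. w c + t * d c)" "\<And>k. k \<in> I \<Longrightarrow> w (Inl k) + t * d (Inl k) \<ge> 0"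
    using leaving_step_length[OF B(1,3,4) w d j] by blast
  obtain t' where t': "t' > 0" "d (Inl j') < 0" "t' = w (Inl j') / - d (Inl j')"
    "solves g (B \<union> {i} - {j'}) (\<lambda>c. w c + t' * d c)" "\<And>k. k \<in> I \<Longrightarrow> w (Inl k) + t' * d (Inl k) \<ge> 0"
    using leaving_step_length[OF B(1,3,4) w d j'] by blast
  have bases: "basis B" "basis (B \<union> {i} - {j})" "basis (B \<union> {i} - {j'})"
    using B(1) j(2) j'(2) by (simp_all add: feasible_def)
  have jB: "j \<in> B" "j' \<in> B"
    using leaving_in[OF bases(1) B(3)] bases(2,3) j(1) j'(1) by blast+
  then have "j \<in> I" "j' \<in> I" using basisD(1)[OF bases(1)] by auto
  have zero: "w (Inl j) + t * d (Inl j) = 0" "w (Inl j') + t' * d (Inl j') = 0"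
    using t(2,3) t'(2,3) by (simp_all add: field_simps)
  \<comment> \<open>Neither step may make the other candidate negative.\<close>
  have "t * d (Inl j) \<le> t' * d (Inl j)" "t' * d (Inl j') \<le> t * d (Inl j')"
    using t(5)[OF \<open>j' \<in> I\<close>] t'(5)[OF \<open>j \<in> I\<close>] zero by linarith+
  then have "t' \<le> t" "t \<le> t'" using t(2) t'(2) by (simp_all add: mult_le_cancel_right)
  then have tt: "t = t'" by simp
  note z = zero[folded tt]
  show False
  proof (cases "j = free")
    case True
    then show False using nondegenerate[OF j(2) t(4), of j'] z ne jB by auto
  next
    case False
    then show False using nondegenerate[OF j'(2) t'(4), of j] z ne jB tt by auto
  qed
qed

text \<open>A leaving index needs a negative entry of \<open>d\<close>. This blocks the reversed
  start and also separates the different starting bases on the primary ray.\<close>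

lemma ray_no_leaving:
  assumes B: "feasible B" "i \<notin> B" "i \<noteq> free" and d: "direction B i d"
    and pos: "\<And>k. k \<in> I \<Longrightarrow> d (Inl k) \<ge> 0" and j: "j \<noteq> i"
  shows "\<not> feasible (B \<union> {i} - {j})"
proof
  assume j': "feasible (B \<union> {i} - {j})"
  obtain w where w: "solves g B w" using B by (auto simp: feasible_def)
  have "d (Inl j) < 0" using leaving_step_length[OF B w d j j'] by blast
  moreover have "j \<in> B" "B \<subseteq> I"
    using leaving_in[of B i j] basisD(1) B j j' by (simp_all add: feasible_def)
  ultimately show False using pos[of j] by auto
qed

end

text \<open>The parity argument behind complementary pivoting: reversing a path by the involution
  \<open>\<sigma>\<close> shows that a path from \<open>s\<close> to \<open>\<sigma> s\<close> would fold onto itself in its middle.\<close>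

locale reversible_steps =
  fixes S :: "'s set" and step :: "'s \<Rightarrow> 's \<Rightarrow> bool" and \<sigma> :: "'s \<Rightarrow> 's" and s0 :: 's
  assumes finite_S: "finite S" and start: "s0 \<in> S"
    and closed: "s \<in> S \<Longrightarrow> step s t \<Longrightarrow> t \<in> S"
    and deterministic: "s \<in> S \<Longrightarrow> step s t \<Longrightarrow> step s t' \<Longrightarrow> t = t'"
    and involution_in: "s \<in> S \<Longrightarrow> \<sigma> s \<in> S"
    and involution: "s \<in> S \<Longrightarrow> \<sigma> (\<sigma> s) = s"
    and no_fixed_point: "s \<in> S \<Longrightarrow> \<sigma> s \<noteq> s"
    and reverse: "s \<in> S \<Longrightarrow> step s t \<Longrightarrow> step (\<sigma> t) (\<sigma> s)"
    and step_not_reverse: "s \<in> S \<Longrightarrow> step s t \<Longrightarrow> t \<noteq> \<sigma> s"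
    and reversed_start_stuck: "\<not> step (\<sigma> s0) t"
begin

lemma path_in:
  assumes "f 0 = s0" "\<And>m. m < n \<Longrightarrow> step (f m) (f (Suc m))" "m \<le> n"
  shows "f m \<in> S"
  using assms(3) by (induction m) (use assms start closed in \<open>auto simp: Suc_le_eq\<close>)

lemma never_reversed_start:
  assumes f: "f 0 = s0" "\<And>m. m < n \<Longrightarrow> step (f m) (f (Suc m))"
  shows "f n \<noteq> \<sigma> s0"
proof
  assume eq: "f n = \<sigma> s0"
  have inS: "f m \<in> S" if "m \<le> n" for m by (rule path_in[of f n, OF f that])
  \<comment> \<open>Reversing the step into \<open>f (n - m)\<close> gives a step out of
    \<open>f m\<close>, which by determinism is the next step of the path itself.\<close>
  have fold: "f m = \<sigma> (f (n - m))" if "m \<le> n" for m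
    using that
  proof (induction m)
    case 0
    then show ?case using f eq involution start by simp
  next
    case (Suc m)
    have "n - m = Suc (n - Suc m)" using Suc.prems by simp
    then have "step (f (n - Suc m)) (f (n - m))" using f(2)[of "n - Suc m"] Suc.prems by simp
    then have "step (f m) (\<sigma> (f (n - Suc m)))"
      using reverse[of "f (n - Suc m)"] inS Suc by simp
    then show ?case using deterministic[OF inS[of m] f(2)[of m]] Suc.prems by simp
  qed
  show False
  \<comment> \<open>For even \<open>n\<close> the middle state is its own reverse; for odd
    \<open>n\<close> the middle step leads from a state to its reverse. Both are excluded.\<close>
  proof (cases "even n")
    case True
    then obtain m where "n = 2 * m" by blast
    then have half: "n - m = m" "m \<le> n" by simp_all
    show False using fold[OF half(2)] no_fixed_point[OF inS[OF half(2)]] unfolding half(1) by metis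
  next
    case False
    then obtain m where n: "n = 2 * m + 1" by (rule oddE)
    then have "f (Suc m) = \<sigma> (f m)" using fold[of "Suc m"] by simp
    then show False using step_not_reverse[OF inS[of m] f(2)[of m]] n by simp
  qed
qed

lemma reachable_not_reversed_start:
  assumes "step\<^sup>*\<^sup>* s0 s"
  shows "s \<in> S" "s \<noteq> \<sigma> s0"
proof -
  obtain n f where "f 0 = s0" "f n = s" "\<And>m. m < n \<Longrightarrow> step (f m) (f (Suc m))"
    using assms unfolding rtranclp_power relpowp_fun_conv by blast
  then show "s \<in> S" "s \<noteq> \<sigma> s0" using path_in[of f n n] never_reversed_start[of f n] by auto
qed

text \<open>Reversal turns determinism into uniqueness of predecessors. A repetition can therefore
  be traced back to one of the initial state, which has no predecessor because its reverse is
  stuck.\<close>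

lemma no_infinite_run:
  assumes f: "f 0 = s0" "\<And>m. step (f m) (f (Suc m))"
  shows False
proof -
  have inS: "f m \<in> S" for m using path_in[of f m m] f by auto
  have pred_unique: "s = s'" if s: "s \<in> S" "s' \<in> S" "step s t" "step s' t" for s s' t
  proof -
    have "\<sigma> t \<in> S" by (rule involution_in[OF closed[OF s(1,3)]])
    then have "\<sigma> s = \<sigma> s'" using deterministic reverse[OF s(1,3)] reverse[OF s(2,4)] by blast
    then show ?thesis using involution[OF s(1)] involution[OF s(2)] by metis
  qed
  have "f m \<noteq> f n" if "m < n" for m n
    using that
  proof (induction m arbitrary: n)
    case 0
    then obtain n' where "n = Suc n'" using gr0_implies_Suc by auto
    then show ?case
      using f(1) f(2)[of n'] reverse[OF inS[of n'] f(2)[of n']] reversed_start_stuck by metis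
  next
    case (Suc m)
    from Suc.prems obtain n' where n: "n = Suc n'" by (cases n) auto
    then have "f m \<noteq> f n'" using Suc.IH[of n'] Suc.prems by simp
    then show ?case using pred_unique[OF inS[of m] inS[of n'] f(2)[of m]] f(2)[of n'] n by metis
  qed
  then have "inj f" by (metis injI linorder_neqE_nat)
  then have "infinite (range f)" by (simp add: range_inj_infinite)
  then show False using finite_subset[OF _ finite_S] inS by blast
qed

end

section \<open>Circulations on forests\<close>

text \<open>A longest path in the support would have to be continued at its end by conservation,
  without reusing an arc, and thereby closes an undirected cycle.\<close>

lemma forest_circulation_zero:
  fixes G :: "('v, 'a) pre_digraph" and x :: "'a \<Rightarrow> real"
  assumes G: "fin_digraph G" and T: "T \<subseteq> arcs G" and forest: "undirected_forest (G\<lparr>arcs := T\<rparr>)"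
    and supp: "\<And>a. a \<in> arcs G \<Longrightarrow> a \<notin> T \<Longrightarrow> x a = 0"
    and conserved: "\<And>v. v \<in> verts G \<Longrightarrow> (\<Sum>a\<in>out_arcs G v. x a) = (\<Sum>a\<in>in_arcs G v. x a)"
    and a: "a \<in> arcs G"
  shows "x a = 0"
proof (rule ccontr)
  assume xa: "x a \<noteq> 0"
  interpret G: fin_digraph G by (rule G)
  define H where "H = bidirect (G\<lparr>arcs := T\<rparr>)"
  have H: "arcs H = T \<times> UNIV" "verts H = verts G"
    "\<And>a. tail H (a, True) = tail G a" "\<And>a. head H (a, True) = head G a"
    "\<And>a. tail H (a, False) = head G a" "\<And>a. head H (a, False) = tail G a"
    by (simp_all add: H_def bidirect_def)
  have ends: "{tail H (a, b), head H (a, b)} = {tail G a, head G a}" for a b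
    using H by (cases b) auto
  interpret H: fin_digraph H
  proof
    fix c assume "c \<in> arcs H"
    then show "tail H c \<in> verts H" "head H c \<in> verts H"
      using T by (auto simp: H_def bidirect_def)
  qed (use H T finite_subset[OF T G.finite_arcs] in auto)
  have no_cycle: False if "H.cycle p" "distinct (map fst p)" for p
    using forest that by (auto simp: undirected_forest_def H_def)
  define S where "S = {a\<in>T. x a \<noteq> 0}"
  have S: "S \<subseteq> T" "\<And>a. a \<in> arcs G \<Longrightarrow> x a \<noteq> 0 \<Longrightarrow> a \<in> S"
    using supp by (auto simp: S_def)
  \<comment> \<open>A loop traversed once is already an undirected cycle.\<close>
  have loop: "tail G a \<noteq> head G a" if a: "a \<in> T" for a
  proof
    assume "tail G a = head G a"
    then have "H.cycle [(a, True)]"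
      using a T H by (auto simp: H.cycle_def H.awalk_simps intro!: exI[of _ "tail G a"])
    then show False using no_cycle by fastforce
  qed
  define len :: "'v \<times> ('a \<times> bool) list \<times> 'v \<Rightarrow> nat" where "len = (\<lambda>(u, p, v). length p)"
  define P where "P = {(u, p, v). H.apath u p v \<and> p \<noteq> [] \<and> fst ` set p \<subseteq> S}"
  have "finite P"
    by (rule finite_subset[OF _ H.apaths_finite_triple]) (auto simp: P_def)
  moreover have "(tail G a, [(a, True)], head G a) \<in> P"
    using S(2)[OF a xa] S(1) T H loop[of a] G.wellformed
    by (auto simp: P_def H.apath_simps)
  ultimately have "Max (len ` P) \<in> len ` P" by (intro Max_in) auto
  then obtain z where z: "z \<in> P" "Max (len ` P) = len z" by blast
  have longest: "len z' \<le> len z" if "z' \<in> P" for z'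
    using Max_ge[of "len ` P" "len z'"] that \<open>finite P\<close> z(2) by simp
  from z(1) obtain u c p v where zeq: "z = (u, c # p, v)"
    by (cases z) (auto simp: P_def neq_Nil_conv)
  obtain a0 b0 where c: "c = (a0, b0)" by (cases c)
  have path: "H.apath u (c # p) v" and inS: "fst ` set (c # p) \<subseteq> S"
    using z(1) zeq by (auto simp: P_def)
  have a0: "a0 \<in> S" "a0 \<in> T" "x a0 \<noteq> 0" using inS c by (auto simp: S_def)
  have u: "u \<in> verts G" "u = tail H c"
    using path H.awalk_hd_in_verts[of u "c # p" v] H(2) by (auto simp: H.apath_def H.awalk_Cons_iff)
  have uinc: "u = tail G a0 \<or> u = head G a0" using u(2) c H by (cases b0) auto
  \<comment> \<open>The path is extended at its first vertex \<open>u\<close>. If \<open>a0\<close>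
    were the only support arc there, conservation at \<open>u\<close> would force its flow to
    vanish, as \<open>a0\<close> is not a loop.\<close>
  have "\<exists>a1\<in>S. a1 \<noteq> a0 \<and> (tail G a1 = u \<or> head G a1 = u)"
  proof (rule ccontr)
    assume "\<not> ?thesis"
    then have none: "x a = 0" if "a \<in> arcs G" "a \<noteq> a0" "tail G a = u \<or> head G a = u" for a
      using S(2)[of a] that by blast
    have "(\<Sum>a\<in>out_arcs G u. x a) = (\<Sum>a\<in>out_arcs G u. if a = a0 then x a0 else 0)"
      "(\<Sum>a\<in>in_arcs G u. x a) = (\<Sum>a\<in>in_arcs G u. if a = a0 then x a0 else 0)"
      using none by (auto intro!: sum.cong)
    moreover have "a0 \<in> arcs G" using a0(2) T by auto
    ultimately have "(if tail G a0 = u then x a0 else 0) = (if head G a0 = u then x a0 else 0)"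
      using conserved[OF u(1)] by (simp add: G.finite_out_arcs G.finite_in_arcs)
    then show False using uinc loop[OF a0(2)] a0(3) by (auto split: if_splits)
  qed
  then obtain a1 where a1: "a1 \<in> S" "a1 \<noteq> a0" "tail G a1 = u \<or> head G a1 = u" by blast
  \<comment> \<open>The orientation is chosen so that \<open>a1\<close> is traversed towards
    \<open>u\<close>.\<close>
  define c1 where "c1 = (a1, head G a1 = u)"
  have c1: "c1 \<in> arcs H" "head H c1 = u" "fst c1 = a1"
    using a1 S(1) H by (cases "head G a1 = u"; auto simp: c1_def)+
  have end_in: "u' \<in> set (H.awalk_verts w q)"
    if "(a, b) \<in> set q" "H.awalk w q w'" "u' = tail G a \<or> u' = head G a" for a b q w w' u'
    using that ends[of a b] H.awalk_verts_arc1[of "(a, b)" q w] H.awalk_verts_arc2[of w q w' "(a, b)"]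
    by (auto simp: doubleton_eq_iff)
  \<comment> \<open>Both orientations of an arc have the same two ends, so using an arc twice would
    repeat a vertex.\<close>
  have dist: "distinct (map fst q)" if "H.apath w q w'" for w q w'
    using that
  proof (induction q arbitrary: w)
    case (Cons d q)
    then have d: "H.apath (head H d) q w'" "w = tail H d" "w \<notin> set (H.awalk_verts (head H d) q)"
      by (auto simp: H.apath_Cons_iff)
    have "w = tail G (fst d) \<or> w = head G (fst d)" using d(2) H by (cases d; cases "snd d") auto
    then have "fst d \<notin> fst ` set q"
      using d end_in[of "fst d" _ q "head H d" w' w] by (fastforce simp: H.apath_def)
    then show ?case using Cons.IH[OF d(1)] by simp
  qed simp
  have a1_fresh: "a1 \<notin> fst ` set p"
  proof
    assume "a1 \<in> fst ` set p"
    then obtain b where "(a1, b) \<in> set p" by auto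
    then have "u \<in> set (H.awalk_verts (head H c) p)"
      using path a1(3) end_in[of a1 b p "head H c" v u] by (auto simp: H.apath_def H.awalk_Cons_iff)
    then show False using path u(2) by (simp add: H.apath_Cons_iff)
  qed
  then have fresh: "a1 \<notin> fst ` set (c # p)" using a1(2) c by simp
  show False
  \<comment> \<open>Either the extended path is longer than the longest one, or the new vertex lies
    on the path and \<open>c1\<close> closes a cycle with the initial piece
    \<open>q\<close>.\<close>
  proof (cases "tail H c1 \<in> set (H.awalk_verts u (c # p))")
    case False
    then have "(tail H c1, c1 # c # p, v) \<in> P"
      using path c1 inS a1(1) by (auto simp: P_def H.apath_Cons_iff[of _ c1])
    then show False using longest[of "(tail H c1, c1 # c # p, v)"] zeq by (simp add: len_def)
  next
    case True
    then obtain q r where q: "c # p = q @ r" "H.awalk u q (tail H c1)"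
      using H.awalk_decomp[OF _ True] path unfolding H.apath_def by blast
    have dq: "distinct (H.awalk_verts u q)"
      using path H.awalk_verts_append[of u q r v] unfolding q(1) H.apath_def by simp
    then have "distinct (map fst q)" using dist q(2) by (simp add: H.apath_def)
    moreover have "a1 \<notin> fst ` set q" using fresh q(1) by auto
    moreover have "H.cycle (c1 # q)"
      unfolding H.cycle_def using c1 q(2) dq
      by (intro exI[of _ "tail H c1"]) (auto simp: H.awalk_Cons_iff)
    ultimately show False using no_cycle[of "c1 # q"] c1 by auto
  qed
qed

text \<open>Dual to the previous lemma: flows on a tree are determined because it has no cycle,
  potentials because it reaches every vertex. Together these make the tree basis
  nonsingular.\<close>

lemma spanning_potential_zero:
  fixes \<pi> :: "'v \<Rightarrow> real"
  assumes "r \<rightarrow>\<^sup>*\<^bsub>G\<lparr>arcs := T\<rparr>\<^esub> v" "\<pi> r = 0"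
    and "\<And>a. a \<in> T \<Longrightarrow> \<pi> (tail G a) = \<pi> (head G a)"
  shows "\<pi> v = 0"
proof -
  have "(r, v) \<in> (arcs_ends (G\<lparr>arcs := T\<rparr>))\<^sup>*" by (rule reachable_rtranclI[OF assms(1)])
  then show ?thesis
  proof (induction rule: rtrancl_induct)
    case (step y z)
    then show ?case using assms(3) by (auto simp: arcs_ends_conv)
  qed (rule assms(2))
qed

section \<open>The network system\<close>

text \<open>\<open>Omega\<close> has no twin; mapping it to itself keeps the function an
  involution.\<close>

fun twin :: "('a, 'k) index \<Rightarrow> ('a, 'k) index" where
  "twin (Phi_x p) = Phi_mu p"
| "twin (Phi_mu p) = Phi_x p"
| "twin Omega = Omega"

lemma twin_twin [simp]: "twin (twin i) = i"
  by (cases i) auto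

lemma twin_neq: "i \<noteq> Omega \<Longrightarrow> twin i \<noteq> i"
  by (cases i) auto

context multiclass_network
begin

lemma finite_class_arcs: "finite (class_arcs N k)"
  using fin_digraph_class_graph[OF multiclass_network_axioms, of k]
  by (simp add: fin_digraph_def fin_digraph_axioms_def)

lemma finite_class_verts: "finite (class_verts N k)"
  using fin_digraph_class_graph[OF multiclass_network_axioms, of k]
  by (simp add: fin_digraph_def fin_digraph_axioms_def)

lemma finite_pairs: "finite (pairs N)"
proof -
  have "pairs N = (\<lambda>(k, a). (a, k)) ` (SIGMA k:classes N. class_arcs N k)"
    by (auto simp: pairs_def)
  then show ?thesis using finite_classes finite_class_arcs by auto
qed

lemma finite_nonsource: "finite (nonsource N)"
proof -
  have "nonsource N = (\<lambda>(k, v). (v, k)) ` (SIGMA k:classes N. class_verts N k - {source N k})"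
    by (auto simp: nonsource_def)
  then show ?thesis using finite_classes finite_class_verts by auto
qed

lemma finite_index_set: "finite (index_set N)"
  using finite_pairs by (simp add: index_set_def)

lemma finite_rows: "finite (Defs.rows N)"
  using finite_pairs finite_nonsource by (simp add: Defs.rows_def)

lemma source_in_class_verts: "k \<in> classes N \<Longrightarrow> source N k \<in> class_verts N k"
  using source_in_verts[of k] wf_digraph.reachable_refl[of "graph N"] fin_digraph
  by (auto simp: class_graph_def Let_def fin_digraph_def)

lemma sum_index_set:
  fixes f :: "('a, 'k) index \<Rightarrow> real"
  shows "(\<Sum>i\<in>index_set N. f i) =
    (\<Sum>p\<in>pairs N. f (Phi_x p)) + (\<Sum>p\<in>pairs N. f (Phi_mu p)) + f Omega"
proof -
  have "(\<Sum>i\<in>index_set N. f i) =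
      (\<Sum>i\<in>Phi_x ` pairs N. f i) + (\<Sum>i\<in>Phi_mu ` pairs N. f i) + (\<Sum>i\<in>{Omega}. f i)"
    unfolding index_set_def using finite_pairs
    by (subst sum.union_disjoint; (subst sum.union_disjoint)?) auto
  then show ?thesis by (simp add: sum.reindex inj_on_def)
qed

text \<open>The entry of \<open>M x\<close> at \<open>c\<close>, the net outflow;
  \<open>drop_along\<close> is the transposed product applied to the potentials.\<close>

definition excess :: "('a \<times> 'k \<Rightarrow> real) \<Rightarrow> 'v \<times> 'k \<Rightarrow> real" where
  "excess x c = (\<Sum>p\<in>pairs N. incidence N c p * x p)"

definition drop_along :: "('v \<times> 'k \<Rightarrow> real) \<Rightarrow> 'a \<times> 'k \<Rightarrow> real" where
  "drop_along \<pi> p = (\<Sum>c\<in>nonsource N. incidence N c p * \<pi> c)"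

text \<open>Transposition of \<open>M\<close>. The pairing of a flow with potential drops depends
  only on its excess: it is zero for circulations and equal for flows with equal demands.\<close>

lemma sum_flow_drop:
  "(\<Sum>p\<in>pairs N. x p * drop_along \<pi> p) = (\<Sum>c\<in>nonsource N. excess x c * \<pi> c)"
  unfolding drop_along_def excess_def sum_distrib_left sum_distrib_right
  by (subst sum.swap) (simp add: mult_ac)

lemma excess_eq:
  assumes k: "k \<in> classes N"
  shows "excess x (v, k) =
    (\<Sum>a\<in>out_arcs (class_graph N k) v. x (a, k)) - (\<Sum>a\<in>in_arcs (class_graph N k) v. x (a, k))"
proof -
  let ?A = "class_arcs N k" and ?G = "class_graph N k"
  have sel: "(\<Sum>a\<in>S. x (a, k)) = (\<Sum>a\<in>?A. of_bool (a \<in> S) * x (a, k))" if "S \<subseteq> ?A" for S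
    using that finite_class_arcs[of k] by (intro sum.mono_neutral_cong_left) auto
  have "excess x (v, k) = (\<Sum>p\<in>(\<lambda>a. (a, k)) ` ?A. incidence N (v, k) p * x p)"
    unfolding excess_def using finite_pairs k
    by (intro sum.mono_neutral_right) (auto simp: pairs_def)
  also have "\<dots> = (\<Sum>a\<in>?A. of_bool (a \<in> out_arcs ?G v) * x (a, k)) -
      (\<Sum>a\<in>?A. of_bool (a \<in> in_arcs ?G v) * x (a, k))"
    by (simp add: sum.reindex inj_on_def left_diff_distrib sum_subtractf)
  also have "\<dots> = (\<Sum>a\<in>out_arcs ?G v. x (a, k)) - (\<Sum>a\<in>in_arcs ?G v. x (a, k))"
    by (subst (1 2) sel) auto
  finally show ?thesis .
qed

text \<open>The flow on each arc is counted once at its tail and, with the opposite sign, once at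
  its head.\<close>

lemma sum_excess:
  assumes k: "k \<in> classes N"
  shows "(\<Sum>v\<in>class_verts N k. excess x (v, k)) = 0"
proof -
  let ?A = "class_arcs N k" and ?G = "class_graph N k" and ?V = "class_verts N k"
  interpret G: fin_digraph ?G by (rule fin_digraph_class_graph[OF multiclass_network_axioms])
  have "(\<Sum>v\<in>?V. \<Sum>a\<in>out_arcs ?G v. x (a, k)) = (\<Sum>a\<in>?A. x (a, k))"
    unfolding out_arcs_def
    by (intro sum.group) auto
  moreover have "(\<Sum>v\<in>?V. \<Sum>a\<in>in_arcs ?G v. x (a, k)) = (\<Sum>a\<in>?A. x (a, k))"
    unfolding in_arcs_def
    by (intro sum.group) auto
  ultimately show ?thesis by (simp add: excess_eq[OF k] sum_subtractf)
qed

text \<open>The source row missing from \<open>M\<close> is redundant, since both sides have sum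
  zero over the vertices of the class.\<close>

lemma excess_source:
  assumes k: "k \<in> classes N" and eq: "\<And>v. (v, k) \<in> nonsource N \<Longrightarrow> excess x (v, k) = g v"
    and "(\<Sum>v\<in>class_verts N k. g v) = 0" and v: "v \<in> class_verts N k"
  shows "excess x (v, k) = g v"
proof (cases "v = source N k")
  case True
  have "(\<Sum>v\<in>class_verts N k - {source N k}. excess x (v, k)) =
      (\<Sum>v\<in>class_verts N k - {source N k}. g v)"
    using eq k by (intro sum.cong) (auto simp: nonsource_def)
  then show ?thesis
    using sum_excess[OF k, of x] assms(3) source_in_class_verts[OF k] finite_class_verts[of k] True
    by (simp add: sum.remove[where x = "source N k"])
qed (use assms in \<open>auto simp: nonsource_def\<close>)

lemma flow_conservation_iff:
  "flow_conservation N x \<longleftrightarrow> (\<forall>(v, k)\<in>nonsource N. excess x (v, k) = demand N k v)"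
proof -
  have "flow_conservation N x \<longleftrightarrow>
      (\<forall>k\<in>classes N. \<forall>v\<in>class_verts N k. excess x (v, k) = demand N k v)"
    unfolding flow_conservation_def by (intro ball_cong) (auto simp: excess_eq)
  also have "\<dots> \<longleftrightarrow> (\<forall>(v, k)\<in>nonsource N. excess x (v, k) = demand N k v)"
  proof
    assume flow: "\<forall>(v, k)\<in>nonsource N. excess x (v, k) = demand N k v"
    show "\<forall>k\<in>classes N. \<forall>v\<in>class_verts N k. excess x (v, k) = demand N k v"
    proof (intro ballI)
      fix k v assume "k \<in> classes N" "v \<in> class_verts N k"
      then show "excess x (v, k) = demand N k v"
        using excess_source[of k x "demand N k" v] demand_sum[of k] flow by fastforce
    qed
  qed (auto simp: nonsource_def)
  finally show ?thesis .
qed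

text \<open>The vertices omitted from the sum are harmless because \<open>\<pi>\<close> vanishes
  there, in particular at the sources.\<close>

lemma drop_along_eq:
  assumes p: "(a, k) \<in> pairs N" and \<pi>: "\<And>c. c \<notin> nonsource N \<Longrightarrow> \<pi> c = 0"
  shows "drop_along \<pi> (a, k) = \<pi> (tail (graph N) a, k) - \<pi> (head (graph N) a, k)"
proof -
  have inc: "incidence N c (a, k) =
      of_bool (c = (tail (graph N) a, k)) - of_bool (c = (head (graph N) a, k))" for c
    using p by (cases c) (auto simp: pairs_def class_graph_def Let_def)
  have sel: "(\<Sum>c\<in>nonsource N. of_bool (c = c0) * \<pi> c) = \<pi> c0" for c0
  proof -
    have "(\<Sum>c\<in>nonsource N. of_bool (c = c0) * \<pi> c) = (\<Sum>c\<in>nonsource N. if c = c0 then \<pi> c else 0)"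
      by (intro sum.cong) auto
    then show ?thesis using finite_nonsource \<pi> by simp
  qed
  show ?thesis unfolding drop_along_def inc left_diff_distrib sum_subtractf sel ..
qed

definition cost :: "('a \<times> 'k \<Rightarrow> real) \<Rightarrow> 'a \<times> 'k \<Rightarrow> real" where
  "cost x = (\<lambda>(a, k). slope N k a * total_flow N x a)"

lemma sum_cost_matrix:
  "(\<Sum>q\<in>pairs N. cost_matrix N p q * x q) = cost x p"
proof -
  obtain a k where p: "p = (a, k)" by (cases p)
  let ?K = "{k'\<in>classes N. a \<in> class_arcs N k'}"
  have "(\<Sum>q\<in>pairs N. cost_matrix N p q * x q) = (\<Sum>q\<in>Pair a ` ?K. cost_matrix N p q * x q)"
    using finite_pairs by (intro sum.mono_neutral_right) (auto simp: pairs_def p)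
  then show ?thesis
    by (simp add: sum.reindex inj_on_def p cost_def total_flow_def sum_distrib_left)
qed

section \<open>Points of the program as vectors of the tableau\<close>

fun vec :: "('v, 'a, 'k) point \<Rightarrow> ('a, 'k) index + 'v \<times> 'k \<Rightarrow> real" where
  "vec (x, \<mu>, \<omega>, \<pi>) = case_sum (coordinate x \<mu> \<omega>) \<pi>"

lemma vec_surj:
  obtains x \<mu> \<omega> \<pi> where "w = vec (x, \<mu>, \<omega>, \<pi>)"
proof
  show "w = vec (\<lambda>p. w (Inl (Phi_x p)), \<lambda>p. w (Inl (Phi_mu p)), w (Inl Omega), \<lambda>c. w (Inr c))"
  proof
    fix c
    show "w c = vec (\<lambda>p. w (Inl (Phi_x p)), \<lambda>p. w (Inl (Phi_mu p)), w (Inl Omega), \<lambda>c. w (Inr c)) c"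
    proof (cases c)
      case (Inl i)
      then show ?thesis by (cases i) auto
    qed auto
  qed
qed

lemma vec_inject: "vec z = vec z' \<Longrightarrow> z = z'"
proof (cases z; cases z')
  fix x \<mu> \<omega> \<pi> x' \<mu>' \<omega>' \<pi>'
  assume z: "vec z = vec z'" "z = (x, \<mu>, \<omega>, \<pi>)" "z' = (x', \<mu>', \<omega>', \<pi>')"
  have eq: "vec z c = vec z' c" for c using z(1) by simp
  have "x p = x' p" "\<mu> p = \<mu>' p" "\<omega> = \<omega>'" "\<pi> q = \<pi>' q" for p q
    using eq[of "Inl (Phi_x p)"] eq[of "Inl (Phi_mu p)"] eq[of "Inl Omega"] eq[of "Inr q"] z(2,3)
    by simp_all
  then show "z = z'" using z(2,3) by auto
qed

abbreviation system_matrix ::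
    "('a \<times> 'k \<Rightarrow> real) \<Rightarrow> 'v \<times> 'k + 'a \<times> 'k \<Rightarrow> ('a, 'k) index + 'v \<times> 'k \<Rightarrow> real" where
  "system_matrix e \<equiv> \<lambda>r. case_sum (M_bar N e r) (pi_columns N r)"

lemma sum_system_matrix:
  "(\<Sum>c\<in>index_set N <+> nonsource N. system_matrix e r c * w c) =
    (\<Sum>i\<in>index_set N. M_bar N e r i * w (Inl i)) +
    (\<Sum>c\<in>nonsource N. pi_columns N r c * w (Inr c))"
  using finite_index_set finite_nonsource by (simp add: sum.Plus)

lemma flow_row:
  "(\<Sum>c\<in>index_set N <+> nonsource N. system_matrix e (Inl c') c * vec (x, \<mu>, \<omega>, \<pi>) c) = excess x c'"
  unfolding sum_system_matrix sum_index_set by (simp add: excess_def)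

lemma cost_row:
  assumes "p \<in> pairs N"
  shows "(\<Sum>c\<in>index_set N <+> nonsource N. system_matrix e (Inr p) c * vec (x, \<mu>, \<omega>, \<pi>) c) =
    cost x p - \<mu> p + e p * \<omega> + drop_along \<pi> p"
proof -
  have "(\<Sum>q\<in>pairs N. - of_bool (p = q) * \<mu> q) = (\<Sum>q\<in>pairs N. if p = q then - \<mu> q else 0)"
    by (intro sum.cong) auto
  also have "\<dots> = - \<mu> p" using assms finite_pairs by simp
  finally show ?thesis
    unfolding sum_system_matrix sum_index_set by (simp add: sum_cost_matrix drop_along_def)
qed

sublocale tableau: simplex_tableau "Defs.rows N" "index_set N" "nonsource N" "system_matrix e" "rhs N"
  for e
  using finite_rows finite_index_set finite_nonsource by unfold_locales

lemma solves_iff: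
  "tableau.solves e h B (vec (x, \<mu>, \<omega>, \<pi>)) \<longleftrightarrow>
    (\<forall>c\<in>nonsource N. excess x c = h (Inl c)) \<and>
    (\<forall>p\<in>pairs N. cost x p - \<mu> p + e p * \<omega> + drop_along \<pi> p = h (Inr p)) \<and>
    supported_by N B (x, \<mu>, \<omega>, \<pi>)"
proof -
  have rows: "(\<forall>r\<in>Defs.rows N. P r) \<longleftrightarrow>
      (\<forall>c\<in>nonsource N. P (Inl c)) \<and> (\<forall>p\<in>pairs N. P (Inr p))" for P
    unfolding Defs.rows_def by blast
  have support: "(\<forall>i. i \<notin> B \<longrightarrow> vec (x, \<mu>, \<omega>, \<pi>) (Inl i) = 0) \<and>
      (\<forall>c. c \<notin> nonsource N \<longrightarrow> vec (x, \<mu>, \<omega>, \<pi>) (Inr c) = 0) \<longleftrightarrow> supported_by N B (x, \<mu>, \<omega>, \<pi>)"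
    by simp
  show ?thesis
    unfolding tableau.solves_def support rows flow_row conj_assoc by (simp add: cost_row del: vec.simps supported_by.simps)
qed

lemma linear_constraints_iff:
  "linear_constraints N e z \<and> supported_by N B z \<longleftrightarrow> tableau.solves e (rhs N) B (vec z)"
proof -
  obtain x \<mu> \<omega> \<pi> where "z = (x, \<mu>, \<omega>, \<pi>)" by (cases z)
  then show ?thesis unfolding tableau.solves_def sum_system_matrix by auto
qed

lemma is_basis_iff: "is_basis N e B \<longleftrightarrow> tableau.basis e B"
  by (simp add: is_basis_def tableau.basis_def)

lemma basic_solution_iff:
  assumes "tableau.basis e B"
  shows "basic_solution N e B z \<longleftrightarrow> tableau.solves e (rhs N) B (vec z)"
proof
  assume "basic_solution N e B z"
  then show "tableau.solves e (rhs N) B (vec z)"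
    by (simp add: basic_solution_def linear_constraints_iff[symmetric])
next
  assume z: "tableau.solves e (rhs N) B (vec z)"
  have "z' = z" if "tableau.solves e (rhs N) B (vec z')" for z'
    by (rule vec_inject) (rule tableau.solves_unique[OF assms that z])
  then show "basic_solution N e B z"
    unfolding basic_solution_def conj_assoc[symmetric] linear_constraints_iff using z by blast
qed

lemma feasible_basis_iff: "feasible_basis N e B \<longleftrightarrow> tableau.feasible e B"
proof -
  have nonneg: "(\<forall>i\<in>index_set N. vec (x, \<mu>, \<omega>, \<pi>) (Inl i) \<ge> 0) \<longleftrightarrow>
      (\<forall>p\<in>pairs N. x p \<ge> 0 \<and> \<mu> p \<ge> 0) \<and> \<omega> \<ge> 0" for x \<mu> \<omega> \<pi>
    by (auto simp: index_set_def ball_Un)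
  have "(\<exists>x \<mu> \<omega> \<pi>. basic_solution N e B (x, \<mu>, \<omega>, \<pi>) \<and>
        (\<forall>p\<in>pairs N. x p \<ge> 0 \<and> \<mu> p \<ge> 0) \<and> \<omega> \<ge> 0) \<longleftrightarrow>
      (\<exists>w. tableau.solves e (rhs N) B w \<and> (\<forall>i\<in>index_set N. w (Inl i) \<ge> 0))"
    if "tableau.basis e B"
  proof
    assume "\<exists>w. tableau.solves e (rhs N) B w \<and> (\<forall>i\<in>index_set N. w (Inl i) \<ge> 0)"
    then obtain w where w: "tableau.solves e (rhs N) B w" "\<forall>i\<in>index_set N. w (Inl i) \<ge> 0" by blast
    obtain x \<mu> \<omega> \<pi> where "w = vec (x, \<mu>, \<omega>, \<pi>)" by (rule vec_surj)
    then have "basic_solution N e B (x, \<mu>, \<omega>, \<pi>)" "(\<forall>p\<in>pairs N. x p \<ge> 0 \<and> \<mu> p \<ge> 0) \<and> \<omega> \<ge> 0"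
      using w nonneg basic_solution_iff[OF that] by blast+
    then show "\<exists>x \<mu> \<omega> \<pi>. basic_solution N e B (x, \<mu>, \<omega>, \<pi>) \<and>
        (\<forall>p\<in>pairs N. x p \<ge> 0 \<and> \<mu> p \<ge> 0) \<and> \<omega> \<ge> 0" by blast
  next
    assume "\<exists>x \<mu> \<omega> \<pi>. basic_solution N e B (x, \<mu>, \<omega>, \<pi>) \<and>
        (\<forall>p\<in>pairs N. x p \<ge> 0 \<and> \<mu> p \<ge> 0) \<and> \<omega> \<ge> 0"
    then show "\<exists>w. tableau.solves e (rhs N) B w \<and> (\<forall>i\<in>index_set N. w (Inl i) \<ge> 0)"
      using nonneg basic_solution_iff[OF that] by blast
  qed
  then show ?thesis
    unfolding feasible_basis_def tableau.feasible_def is_basis_iff by blast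
qed

end

section \<open>Trees and the starting basis\<close>

locale tree_network = multiclass_network N for N :: "('v, 'a, 'k) network" +
  fixes T :: "'k \<Rightarrow> 'a set" and e :: "'a \<times> 'k \<Rightarrow> real"
  assumes arborescence: "k \<in> classes N \<Longrightarrow> arborescence (class_graph N k) (source N k) (T k)"
    and routable: "routable_on N T"
    and e_def: "e = tree_vector T"
    and nondegenerate_network: "nondegenerate N e"
begin

abbreviation on_tree :: "'a \<times> 'k \<Rightarrow> bool" where
  "on_tree p \<equiv> fst p \<in> T (snd p)"

lemma e_eq: "e p = (if on_tree p then 0 else 1)"
  by (cases p) (simp add: e_def)

lemma tree_arcs: "k \<in> classes N \<Longrightarrow> T k \<subseteq> class_arcs N k"
  using arborescence[of k] by (auto simp: arborescence_def spanning_def subgraph_def)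

lemma tree_circulation_zero:
  assumes ex: "\<And>c. c \<in> nonsource N \<Longrightarrow> excess x c = 0"
    and off: "\<And>p. p \<in> pairs N \<Longrightarrow> \<not> on_tree p \<Longrightarrow> x p = 0"
    and p: "p \<in> pairs N"
  shows "x p = 0"
proof -
  obtain a k where ak: "p = (a, k)" "k \<in> classes N" "a \<in> class_arcs N k"
    using p by (auto simp: pairs_def)
  have "x (a, k) = 0"
  proof (rule forest_circulation_zero[of "class_graph N k" "T k" "\<lambda>a. x (a, k)"])
    show "fin_digraph (class_graph N k)"
      by (rule fin_digraph_class_graph[OF multiclass_network_axioms])
    show "undirected_forest (class_graph N k\<lparr>arcs := T k\<rparr>)"
      using arborescence[OF ak(2)] by (simp add: arborescence_def undirected_tree_def)
    show "x (a, k) = 0" if "a \<in> class_arcs N k" "a \<notin> T k" for a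
      using off[of "(a, k)"] that ak by (simp add: pairs_def)
    show "(\<Sum>a\<in>out_arcs (class_graph N k) v. x (a, k)) = (\<Sum>a\<in>in_arcs (class_graph N k) v. x (a, k))"
      if "v \<in> class_verts N k" for v
    proof -
      have "excess x (v, k) = 0"
        using ex that by (intro excess_source[OF ak(2), of x "\<lambda>_. 0" v]) auto
      then show ?thesis by (simp add: excess_eq[OF ak(2)])
    qed
  qed (use ak tree_arcs in auto)
  then show ?thesis using ak by simp
qed

lemma tree_flow_unique:
  assumes "\<And>c. c \<in> nonsource N \<Longrightarrow> excess x c = excess y c"
    and "\<And>p. p \<in> pairs N \<Longrightarrow> \<not> on_tree p \<Longrightarrow> x p = y p"
    and "p \<in> pairs N"
  shows "x p = y p"
proof -
  have "excess (\<lambda>p. x p - y p) c = excess x c - excess y c" for c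
    by (simp add: excess_def right_diff_distrib sum_subtractf)
  then show ?thesis using tree_circulation_zero[of "\<lambda>p. x p - y p" p] assms by simp
qed

lemma tree_potential_zero:
  assumes \<pi>: "\<And>c. c \<notin> nonsource N \<Longrightarrow> \<pi> c = 0"
    and drop0: "\<And>p. p \<in> pairs N \<Longrightarrow> on_tree p \<Longrightarrow> drop_along \<pi> p = 0"
  shows "\<pi> c = 0"
proof (cases "c \<in> nonsource N")
  case True
  then obtain v k where c: "c = (v, k)" "k \<in> classes N" "v \<in> class_verts N k"
    by (auto simp: nonsource_def)
  have "\<pi> (v, k) = 0"
  proof (rule spanning_potential_zero[where r = "source N k" and G = "class_graph N k" and T = "T k"
        and \<pi> = "\<lambda>v. \<pi> (v, k)"])
    show "source N k \<rightarrow>\<^sup>*\<^bsub>class_graph N k\<lparr>arcs := T k\<rparr>\<^esub> v"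
      using arborescence[OF c(2)] c(3) by (simp add: arborescence_def)
    show "\<pi> (source N k, k) = 0" by (rule \<pi>) (simp add: nonsource_def)
    show "\<pi> (tail (class_graph N k) a, k) = \<pi> (head (class_graph N k) a, k)" if "a \<in> T k" for a
    proof -
      have p: "(a, k) \<in> pairs N" using that tree_arcs[OF c(2)] c(2) by (auto simp: pairs_def)
      show ?thesis
        using drop0[OF p] drop_along_eq[OF p \<pi>] that by (simp add: class_graph_def Let_def)
    qed
  qed
  then show ?thesis using c by simp
qed (rule \<pi>)

text \<open>\<open>routable_on\<close> provides such a flow; its entries on \<open>pairs N\<close>
  do not depend on the choice, by \<open>tree_flow_unique\<close>.\<close>

definition tree_flow :: "'a \<times> 'k \<Rightarrow> real" where
  "tree_flow = (SOME x. flow_conservation N x \<and> (\<forall>p\<in>pairs N. x p \<ge> 0 \<and> (\<not> on_tree p \<longrightarrow> x p = 0)))"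

lemma tree_flow:
  shows excess_tree_flow: "c \<in> nonsource N \<Longrightarrow> excess tree_flow c = rhs N (Inl c)"
    and tree_flow_nonneg: "p \<in> pairs N \<Longrightarrow> tree_flow p \<ge> 0"
    and tree_flow_off: "p \<in> pairs N \<Longrightarrow> \<not> on_tree p \<Longrightarrow> tree_flow p = 0"
proof -
  have "\<exists>x. flow_conservation N x \<and> (\<forall>p\<in>pairs N. x p \<ge> 0 \<and> (\<not> on_tree p \<longrightarrow> x p = 0))"
    using routable unfolding routable_on_def by (simp add: case_prod_unfold)
  from someI_ex[OF this, folded tree_flow_def]
  show "c \<in> nonsource N \<Longrightarrow> excess tree_flow c = rhs N (Inl c)" "p \<in> pairs N \<Longrightarrow> tree_flow p \<ge> 0"
    "p \<in> pairs N \<Longrightarrow> \<not> on_tree p \<Longrightarrow> tree_flow p = 0"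
    unfolding flow_conservation_iff by (cases c; auto)+
qed

lemma tree_flow_eq:
  assumes "tableau.solves e (rhs N) B (vec (x, \<mu>, \<omega>, \<pi>))"
    and "\<And>p. p \<in> pairs N \<Longrightarrow> \<not> on_tree p \<Longrightarrow> x p = 0" and "p \<in> pairs N"
  shows "x p = tree_flow p"
proof (rule tree_flow_unique[OF _ _ assms(3)])
  show "excess x c = excess tree_flow c" if "c \<in> nonsource N" for c
    using assms(1) excess_tree_flow[OF that] that unfolding solves_iff by simp
  show "x q = tree_flow q" if "q \<in> pairs N" "\<not> on_tree q" for q
    using assms(2)[OF that] tree_flow_off[OF that] by simp
qed

sublocale nondegenerate_tableau "Defs.rows N" "index_set N" "nonsource N" "system_matrix e" "rhs N" Omega
proof
  fix B w i
  assume B: "tableau.feasible e B" "tableau.solves e (rhs N) B w" "i \<in> B" "i \<noteq> Omega"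
  obtain x \<mu> \<omega> \<pi> where w: "w = vec (x, \<mu>, \<omega>, \<pi>)" by (rule vec_surj)
  have basis: "tableau.basis e B" using B(1) by (simp add: tableau.feasible_def)
  then have "basic_solution N e B (x, \<mu>, \<omega>, \<pi>)" using B(2) w by (simp add: basic_solution_iff)
  then have pos: "\<forall>p\<in>pairs N. (Phi_x p \<in> B \<longrightarrow> x p > 0) \<and> (Phi_mu p \<in> B \<longrightarrow> \<mu> p > 0)"
    using nondegenerate_network B(1) unfolding nondegenerate_def feasible_basis_iff by blast
  have "i \<in> index_set N" using basis B(3) by (auto simp: tableau.basis_def)
  then consider p where "i = Phi_x p" "p \<in> pairs N" | p where "i = Phi_mu p" "p \<in> pairs N"
    using B(4) by (auto simp: index_set_def)
  then show "w (Inl i) > 0" using pos B(3) w by cases auto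
qed

definition tree_set :: "('a, 'k) index set" where
  "tree_set = Phi_x ` {p\<in>pairs N. on_tree p} \<union> Phi_mu ` {p\<in>pairs N. \<not> on_tree p}"

lemma initial_set_eq: "initial_set N T = insert Omega tree_set"
proof -
  have "{(a, k). k \<in> classes N \<and> a \<in> T k} = {p \<in> pairs N. on_tree p}"
    using tree_arcs by (auto simp: pairs_def)
  moreover have "{(a, k). k \<in> classes N \<and> a \<in> class_arcs N k - T k} = {p \<in> pairs N. \<not> on_tree p}"
    by (auto simp: pairs_def)
  ultimately show ?thesis by (simp add: initial_set_def tree_set_def)
qed

lemma tree_set_iff [simp]:
  "Phi_x p \<in> tree_set \<longleftrightarrow> p \<in> pairs N \<and> on_tree p"
  "Phi_mu p \<in> tree_set \<longleftrightarrow> p \<in> pairs N \<and> \<not> on_tree p"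
  "Omega \<notin> tree_set"
  by (auto simp: tree_set_def)

lemma card_rows: "card (Defs.rows N) = card (pairs N) + card (nonsource N)"
  using finite_pairs finite_nonsource by (simp add: Defs.rows_def card_Plus)

lemma card_basis: "tableau.basis e B \<Longrightarrow> card B = card (pairs N)"
  using tableau.basis_card[of e B] card_rows by simp

text \<open>The system is block triangular. The flow is a circulation on forests, hence zero;
  \<open>\<omega>\<close> is not basic; the tree rows, which contain no basic \<open>\<mu>\<close>,
  then kill the potentials; the remaining rows kill \<open>\<mu>\<close>.\<close>

lemma basis_tree_set: "tableau.basis e tree_set"
proof (rule tableau.basisI)
  show "tree_set \<subseteq> index_set N" by (auto simp: tree_set_def index_set_def)
  have "card tree_set = card {p\<in>pairs N. on_tree p} + card {p\<in>pairs N. \<not> on_tree p}"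
    unfolding tree_set_def using finite_pairs
    by (subst card_Un_disjoint) (auto simp: card_image inj_on_def)
  also have "\<dots> = card (pairs N)"
    using finite_pairs by (subst card_Un_disjoint[symmetric]) (auto intro: arg_cong[of _ _ card])
  finally show "card tree_set + card (nonsource N) = card (Defs.rows N)" by (simp add: card_rows)
  fix w assume w: "tableau.solves e (\<lambda>_. 0) tree_set w"
  obtain x \<mu> \<omega> \<pi> where weq: "w = vec (x, \<mu>, \<omega>, \<pi>)" by (rule vec_surj)
  have ex: "\<And>c. c \<in> nonsource N \<Longrightarrow> excess x c = 0"
    and row: "\<And>p. p \<in> pairs N \<Longrightarrow> cost x p - \<mu> p + e p * \<omega> + drop_along \<pi> p = 0"
    and supp: "\<And>i. i \<notin> tree_set \<Longrightarrow> coordinate x \<mu> \<omega> i = 0" "\<And>c. c \<notin> nonsource N \<Longrightarrow> \<pi> c = 0"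
    using w unfolding weq solves_iff by auto
  have x0: "x p = 0" for p
    using tree_circulation_zero[of x p] ex supp(1)[of "Phi_x p"] supp(1)[of "Phi_x _"]
    by (metis coordinate.simps(1) tree_set_iff(1))
  have cost0: "cost x p = 0" for p by (cases p) (simp add: cost_def total_flow_def x0)
  have \<omega>0: "\<omega> = 0" using supp(1)[of Omega] by simp
  have \<pi>0: "\<pi> c = 0" for c
  proof (rule tree_potential_zero[OF supp(2)])
    fix p assume "p \<in> pairs N" "on_tree p"
    then show "drop_along \<pi> p = 0"
      using row[of p] supp(1)[of "Phi_mu p"] cost0 \<omega>0 by simp
  qed
  have \<mu>0: "\<mu> p = 0" for p
  proof (cases "p \<in> pairs N")
    case True
    then show ?thesis using row[of p] cost0 \<omega>0 by (simp add: drop_along_def \<pi>0)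
  next
    case False
    then show ?thesis using supp(1)[of "Phi_mu p"] by simp
  qed
  show "w = (\<lambda>_. 0)"
  proof
    fix c show "w c = 0"
    proof (cases c)
      case (Inl i)
      then show ?thesis by (cases i) (simp_all add: weq x0 \<mu>0 \<omega>0)
    qed (simp add: weq \<pi>0)
  qed
qed

text \<open>Raising \<open>\<omega>\<close> is absorbed by \<open>\<mu>\<close> off the trees: this is the primary ray.\<close>

definition primary_ray :: "('a, 'k) index + 'v \<times> 'k \<Rightarrow> real" where
  "primary_ray = vec (\<lambda>_. 0, \<lambda>p. if p \<in> pairs N then e p else 0, 1, \<lambda>_. 0)"

lemma primary_ray_simps [simp]:
  "primary_ray (Inl (Phi_x p)) = 0"
  "primary_ray (Inl (Phi_mu p)) = (if p \<in> pairs N \<and> \<not> on_tree p then 1 else 0)"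
  "primary_ray (Inl Omega) = 1" "primary_ray (Inr c) = 0"
  by (simp_all add: primary_ray_def e_eq)

lemma primary_ray_nonneg: "primary_ray (Inl i) \<ge> 0"
  by (cases i) simp_all

lemma solves_primary_ray: "tableau.solves e (\<lambda>_. 0) (insert Omega tree_set) primary_ray"
proof -
  have "supported_by N (insert Omega tree_set)
      (\<lambda>_. 0, \<lambda>p. if p \<in> pairs N then e p else 0, 1, \<lambda>_. 0)"
  proof -
    have "coordinate (\<lambda>_. 0) (\<lambda>p. if p \<in> pairs N then e p else 0) 1 i = 0"
      if "i \<notin> insert Omega tree_set" for i
      using that by (cases i) (auto simp: e_eq)
    then show ?thesis by simp
  qed
  moreover have "cost (\<lambda>_. 0) p = 0" for p by (cases p) (simp add: cost_def total_flow_def)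
  ultimately show ?thesis
    unfolding primary_ray_def solves_iff by (simp add: excess_def drop_along_def)
qed

definition start_set :: "'a \<times> 'k \<Rightarrow> ('a, 'k) index set" where
  "start_set p = insert Omega tree_set - {Phi_mu p}"

lemma start_set_eq: "initial_set N T - {Phi_mu p} = start_set p"
  by (simp add: start_set_def initial_set_eq)

lemma complementary_tree_set: "complementary N (insert Omega tree_set)"
  by (auto simp: complementary_def)

lemma complementary_mono: "complementary N B \<Longrightarrow> B' \<subseteq> B \<Longrightarrow> complementary N B'"
  by (auto simp: complementary_def)

lemma complementary_start_set: "complementary N (start_set p)"
  by (rule complementary_mono[OF complementary_tree_set]) (auto simp: start_set_def)

text \<open>A pivot in \<open>tree_set\<close>: the primary ray is the direction of the entering
  index \<open>Omega\<close>, and its entry at \<open>Phi_mu p\<close> is 1.\<close>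

lemma basis_start_set:
  assumes "p \<in> pairs N" "\<not> on_tree p"
  shows "tableau.basis e (start_set p)"
proof -
  have "tableau.direction e tree_set Omega primary_ray"
    using solves_primary_ray by (simp add: tableau.direction_def)
  then have "tableau.basis e (tree_set \<union> {Omega} - {Phi_mu p})"
    using assms basis_tree_set by (intro tableau.basis_pivot) (auto simp: index_set_def)
  then show ?thesis by (simp add: start_set_def)
qed

text \<open>The ray has entry 1 at both \<open>Omega\<close> and \<open>Phi_mu p\<close>, so the
  same vector serves when \<open>Phi_mu p\<close> enters instead.\<close>

lemma direction_start_set:
  assumes "p \<in> pairs N" "\<not> on_tree p"
  shows "tableau.direction e (start_set p) (Phi_mu p) primary_ray"
proof -
  have "insert (Phi_mu p) (start_set p) = insert Omega tree_set"
    using assms by (auto simp: start_set_def)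
  then show ?thesis using solves_primary_ray assms by (simp add: tableau.direction_def)
qed

text \<open>The algorithm does not say that its starting pair lies off the tree. If it did not, no
  index would be removed and the set would be too large for a basis.\<close>

lemma start_off_tree:
  assumes "tableau.basis e (start_set p)"
  shows "p \<in> pairs N" "\<not> on_tree p"
proof -
  have "Phi_mu p \<in> tree_set"
  proof (rule ccontr)
    assume "Phi_mu p \<notin> tree_set"
    then have "start_set p = insert Omega tree_set" by (auto simp: start_set_def)
    then have "card (start_set p) = Suc (card tree_set)"
      using tableau.basisD(2)[OF basis_tree_set] by simp
    then show False using card_basis[OF basis_tree_set] card_basis[OF assms] by simp
  qed
  then show "p \<in> pairs N" "\<not> on_tree p" by simp_all
qed

text \<open>The flow of a starting basis is supported on the trees, so it is the tree flow; all tree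
  arcs are basic, and non-degeneracy applies.\<close>

lemma tree_flow_pos:
  assumes "tableau.feasible e (start_set p0)" "p \<in> pairs N" "on_tree p"
  shows "tree_flow p > 0"
proof -
  obtain w where w: "tableau.solves e (rhs N) (start_set p0) w"
    using assms(1) by (auto simp: tableau.feasible_def)
  obtain x \<mu> \<omega> \<pi> where weq: "w = vec (x, \<mu>, \<omega>, \<pi>)" by (rule vec_surj)
  have "x q = 0" if "\<not> on_tree q" for q
    using w that unfolding weq solves_iff
    by (auto simp: start_set_def dest!: spec[of _ "Phi_x q"])
  then have "x p = tree_flow p" by (rule tree_flow_eq[OF w[unfolded weq] _ assms(2)])
  moreover have "w (Inl (Phi_x p)) > 0"
    using nondegenerate[OF assms(1) w, of "Phi_x p"] assms by (simp add: start_set_def)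
  ultimately show ?thesis by (simp add: weq)
qed

end

section \<open>Rays\<close>

context tree_network
begin

abbreviation fcb :: "('a, 'k) index set \<Rightarrow> bool" where
  "fcb B \<equiv> tableau.feasible e B \<and> complementary N B"

lemma total_flow_ge:
  assumes "\<And>q. q \<in> pairs N \<Longrightarrow> x q \<ge> 0" "(a, k) \<in> pairs N"
  shows "x (a, k) \<le> total_flow N x a"
  unfolding total_flow_def
  using assms finite_classes by (intro member_le_sum) (auto simp: pairs_def)

text \<open>Pairing the cost rows of the direction with its own flow kills the flow; comparing the
  flow of the basis with the tree flow, which is positive, then kills \<open>\<mu>\<close> on the trees.\<close>

lemma ray_lemma:
  assumes B: "tableau.solves e (rhs N) B (vec (x, \<mu>, \<omega>, \<pi>))"
    and x: "\<And>p. p \<in> pairs N \<Longrightarrow> x p \<ge> 0"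
    and d: "tableau.solves e (\<lambda>_. 0) B' (vec (dx, d\<mu>, d\<omega>, d\<pi>))"
    and d_nonneg: "\<And>p. p \<in> pairs N \<Longrightarrow> dx p \<ge> 0" "\<And>p. p \<in> pairs N \<Longrightarrow> d\<mu> p \<ge> 0" "d\<omega> \<ge> 0"
    and compl: "\<And>p. p \<in> pairs N \<Longrightarrow> dx p * d\<mu> p = 0" "\<And>p. p \<in> pairs N \<Longrightarrow> x p * d\<mu> p = 0"
    and tree_flow_pos: "\<And>p. p \<in> pairs N \<Longrightarrow> on_tree p \<Longrightarrow> tree_flow p > 0"
  shows "p \<in> pairs N \<Longrightarrow> dx p = 0" "p \<in> pairs N \<Longrightarrow> d\<mu> p = e p * d\<omega>"
    "p \<in> pairs N \<Longrightarrow> x p * e p * d\<omega> = 0"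
proof -
  have flow: "\<And>c. c \<in> nonsource N \<Longrightarrow> excess x c = rhs N (Inl c)"
    using B unfolding solves_iff by blast
  have dex: "\<And>c. c \<in> nonsource N \<Longrightarrow> excess dx c = 0"
    and drow: "\<And>p. p \<in> pairs N \<Longrightarrow> cost dx p - d\<mu> p + e p * d\<omega> + drop_along d\<pi> p = 0"
    and dsupp: "\<And>c. c \<notin> nonsource N \<Longrightarrow> d\<pi> c = 0"
    using d unfolding solves_iff by auto
  have e: "e p \<ge> 0" for p by (simp add: e_eq)
  \<comment> \<open>The total flow on the arc is at least \<open>dx p\<close>, so the product is at
    least the positive slope times the square of \<open>dx p\<close>.\<close>
  have cost_ge: "dx p * cost dx p \<ge> 0" "dx p * cost dx p = 0 \<Longrightarrow> dx p = 0" if p: "p \<in> pairs N" for p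
  proof -
    obtain a k where ak: "p = (a, k)" by (cases p)
    have s: "slope N k a > 0" using slope_pos p ak by (auto simp: pairs_def)
    have t: "dx p \<le> total_flow N dx a" using total_flow_ge[of dx a k] d_nonneg(1) p ak by simp
    show "dx p * cost dx p \<ge> 0" using s t d_nonneg(1)[OF p] by (simp add: cost_def ak)
    show "dx p = 0" if "dx p * cost dx p = 0"
      using that s t d_nonneg(1)[OF p] by (auto simp: cost_def ak)
  qed
  \<comment> \<open>Each cost row is multiplied by \<open>dx p\<close>; complementarity removes the
    term with \<open>d\<mu>\<close>.\<close>
  have "(\<Sum>p\<in>pairs N. dx p * cost dx p + dx p * (e p * d\<omega>)) =
      (\<Sum>p\<in>pairs N. - (dx p * drop_along d\<pi> p))"
  proof (rule sum.cong)
    fix p assume p: "p \<in> pairs N"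
    have "dx p * (cost dx p - d\<mu> p + e p * d\<omega> + drop_along d\<pi> p) = 0" using drow[OF p] by simp
    then have "dx p * cost dx p - dx p * d\<mu> p + dx p * (e p * d\<omega>) + dx p * drop_along d\<pi> p = 0"
      by (simp add: distrib_left right_diff_distrib)
    then show "dx p * cost dx p + dx p * (e p * d\<omega>) = - (dx p * drop_along d\<pi> p)"
      using compl(1)[OF p] by linarith
  qed simp
  \<comment> \<open>\<open>dx\<close> is a circulation. All terms on the left are nonnegative, so
    each vanishes.\<close>
  also have "\<dots> = 0" using dex by (simp add: sum_negf sum_flow_drop)
  finally have "\<forall>p\<in>pairs N. dx p * cost dx p + dx p * (e p * d\<omega>) = 0"
    using finite_pairs cost_ge(1) d_nonneg(1,3) e by (subst (asm) sum_nonneg_eq_0_iff) auto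
  then have dx0: "dx p = 0" if "p \<in> pairs N" for p
    using that cost_ge[OF that] d_nonneg(1)[OF that] d_nonneg(3) e[of p]
    by (metis add_nonneg_eq_0_iff mult_nonneg_nonneg)
  have "total_flow N dx a = 0" for a
    unfolding total_flow_def using dx0 by (intro sum.neutral) (auto simp: pairs_def)
  then have "cost dx p = 0" for p by (cases p) (simp add: cost_def)
  then have drop: "drop_along d\<pi> p = d\<mu> p - e p * d\<omega>" if "p \<in> pairs N" for p
    using drow[OF that] by simp
  \<comment> \<open>Equal demands give equal pairings. The left one is at most 0 by complementarity,
    the right one is at least 0 since \<open>e\<close> vanishes on the trees, so both vanish term by
    term.\<close>
  have "(\<Sum>p\<in>pairs N. x p * drop_along d\<pi> p) = (\<Sum>p\<in>pairs N. tree_flow p * drop_along d\<pi> p)"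
    unfolding sum_flow_drop using flow excess_tree_flow by simp
  moreover have "(\<Sum>p\<in>pairs N. x p * drop_along d\<pi> p) = (\<Sum>p\<in>pairs N. - (x p * e p * d\<omega>))"
    using compl(2) by (intro sum.cong) (auto simp: drop right_diff_distrib)
  moreover have "(\<Sum>p\<in>pairs N. tree_flow p * drop_along d\<pi> p) = (\<Sum>p\<in>pairs N. tree_flow p * d\<mu> p)"
    using tree_flow_off by (intro sum.cong) (auto simp: drop right_diff_distrib e_eq)
  ultimately have "(\<Sum>p\<in>pairs N. tree_flow p * d\<mu> p + x p * e p * d\<omega>) = 0"
    by (simp add: sum.distrib sum_negf)
  moreover have nonneg: "tree_flow p * d\<mu> p \<ge> 0" "x p * e p * d\<omega> \<ge> 0" if "p \<in> pairs N" for p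
    using that tree_flow_nonneg d_nonneg x e by simp_all
  ultimately have zero: "\<forall>p\<in>pairs N. tree_flow p * d\<mu> p + x p * e p * d\<omega> = 0"
    using finite_pairs by (subst (asm) sum_nonneg_eq_0_iff) auto
  have zero: "tree_flow p * d\<mu> p = 0" "x p * e p * d\<omega> = 0" if "p \<in> pairs N" for p
    using bspec[OF zero that] nonneg[OF that] by linarith+
  have "d\<pi> c = 0" for c
  proof (rule tree_potential_zero[OF dsupp])
    fix p assume p: "p \<in> pairs N" "on_tree p"
    then have "d\<mu> p = 0" using zero(1)[OF p(1)] tree_flow_pos[OF p] by simp
    then show "drop_along d\<pi> p = 0" using drop[OF p(1)] p(2) by (simp add: e_eq)
  qed
  then have "drop_along d\<pi> p = 0" for p by (simp add: drop_along_def)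
  then show "p \<in> pairs N \<Longrightarrow> d\<mu> p = e p * d\<omega>" using drop[of p] by simp
  show "p \<in> pairs N \<Longrightarrow> dx p = 0" "p \<in> pairs N \<Longrightarrow> x p * e p * d\<omega> = 0"
    using dx0 zero(2) by auto
qed

lemma complementary_insert:
  assumes "complementary N B" "i \<in> twin_indices N B"
  shows "complementary N (insert i B)"
  using assms by (auto simp: complementary_def twin_indices_def)

lemma twin_indicesE:
  assumes "i \<in> twin_indices N B"
  obtains p where "p \<in> pairs N" "Phi_x p \<notin> B" "Phi_mu p \<notin> B" "i = Phi_x p \<or> i = Phi_mu p"
  using assms by (auto simp: twin_indices_def)

lemma twin_indices_props:
  assumes "i \<in> twin_indices N B"
  shows "i \<in> index_set N" "i \<notin> B" "i \<noteq> Omega"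
  using assms by (auto simp: twin_indices_def index_set_def)

text \<open>On a ray \<open>\<omega>\<close> must grow, which forces the current flow off the
  non-tree arcs, so it is the tree flow. Positivity of \<open>x\<close> on the trees and of
  \<open>d\<mu>\<close> off them then determines \<open>insert i B\<close>.\<close>

lemma secondary_ray:
  assumes B: "fcb B" "Omega \<in> B" and i: "i \<in> twin_indices N B"
    and d: "tableau.direction e B i d" "\<And>k. k \<in> index_set N \<Longrightarrow> d (Inl k) \<ge> 0"
    and start: "tableau.feasible e (start_set p0)"
  shows "i = Phi_mu p0" "B = start_set p0"
proof -
  note i' = twin_indices_props[OF i]
  have BI: "B \<subseteq> index_set N" using B(1) by (simp add: tableau.feasible_def tableau.basis_def)
  have p0: "p0 \<in> pairs N" "\<not> on_tree p0"
    using start_off_tree[of p0] start by (simp_all add: tableau.feasible_def)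
  obtain w where w: "tableau.solves e (rhs N) B w" "\<forall>i\<in>index_set N. w (Inl i) \<ge> 0"
    using B(1) by (auto simp: tableau.feasible_def)
  obtain x \<mu> \<omega> \<pi> where weq: "w = vec (x, \<mu>, \<omega>, \<pi>)" by (rule vec_surj)
  obtain dx d\<mu> d\<omega> d\<pi> where deq: "d = vec (dx, d\<mu>, d\<omega>, d\<pi>)" by (rule vec_surj)
  have dsol: "tableau.solves e (\<lambda>_. 0) (insert i B) (vec (dx, d\<mu>, d\<omega>, d\<pi>))" and di: "d (Inl i) = 1"
    using d(1) by (simp_all add: tableau.direction_def deq)
  have xB: "x p = 0" if "Phi_x p \<notin> B" for p
    using w(1) that unfolding weq solves_iff by (auto dest!: spec[of _ "Phi_x p"])
  have dB: "dx p = 0" if "Phi_x p \<notin> insert i B" for p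
    using dsol that unfolding solves_iff by (auto dest!: spec[of _ "Phi_x p"])
  have d\<mu>B: "d\<mu> p = 0" if "Phi_mu p \<notin> insert i B" for p
    using dsol that unfolding solves_iff by (auto dest!: spec[of _ "Phi_mu p"])
  have compl: "complementary N (insert i B)" by (rule complementary_insert) (use B i in auto)
  have x_nonneg: "x p \<ge> 0" if "p \<in> pairs N" for p
    using w(2) that weq by (auto simp: index_set_def ball_Un)
  have d_nonneg: "dx p \<ge> 0" "d\<mu> p \<ge> 0" "d\<omega> \<ge> 0" if "p \<in> pairs N" for p
    using d(2)[of "Phi_x p"] d(2)[of "Phi_mu p"] d(2)[of Omega] that
    by (auto simp: index_set_def deq)
  have d\<omega>_nonneg: "d\<omega> \<ge> 0" using d_nonneg(3)[OF p0(1)] .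
  have prods: "dx p * d\<mu> p = 0" "x p * d\<mu> p = 0" if "p \<in> pairs N" for p
    using compl that dB[of p] d\<mu>B[of p] xB[of p] unfolding complementary_def by auto
  have ray: "dx p = 0" "d\<mu> p = e p * d\<omega>" "x p * e p * d\<omega> = 0" if "p \<in> pairs N" for p
    by (rule ray_lemma[OF w(1)[unfolded weq] _ dsol _ _ d\<omega>_nonneg _ _ _ that];
        use x_nonneg d_nonneg prods tree_flow_pos[OF start] in simp)+
  obtain p where p: "p \<in> pairs N" "i = Phi_x p \<or> i = Phi_mu p" using i by (rule twin_indicesE)
  \<comment> \<open>The direction is 1 at \<open>i\<close> but has no flow, so \<open>i\<close>
    cannot be an \<open>x\<close>-index.\<close>
  have ip: "i = Phi_mu p" "e p \<noteq> 0" "d\<omega> \<noteq> 0"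
    using p ray(1,2)[OF p(1)] di by (auto simp: deq)
  have off: "x q = 0" if "q \<in> pairs N" "\<not> on_tree q" for q
    using ray(3)[OF that(1)] that(2) ip(3) by (simp add: e_eq)
  have sub: "insert Omega tree_set \<subseteq> insert i B"
  proof
    fix j assume "j \<in> insert Omega tree_set"
    then consider "j = Omega" | q where "j = Phi_x q" "q \<in> pairs N" "on_tree q"
      | q where "j = Phi_mu q" "q \<in> pairs N" "\<not> on_tree q"
      by (auto simp: tree_set_def)
    then show "j \<in> insert i B"
    proof cases
      case 2
      then have "x q = tree_flow q" by (intro tree_flow_eq[OF w(1)[unfolded weq] off])
      then show ?thesis using xB[of q] tree_flow_pos[OF start 2(2,3)] 2(1) by auto
    next
      case 3
      then show ?thesis using ray(2)[OF 3(2)] d\<mu>B[of q] ip(3) by (auto simp: e_eq)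
    qed (use B in auto)
  qed
  \<comment> \<open>By complementarity an additional index would exclude its twin, which is already
    present.\<close>
  have "j \<in> insert Omega tree_set" if "j \<in> insert i B" for j
  proof -
    have "j \<in> index_set N" using that BI i'(1) by auto
    then consider "j = Omega" | q where "j = Phi_x q" "q \<in> pairs N" | q where "j = Phi_mu q" "q \<in> pairs N"
      by (auto simp: index_set_def)
    then show ?thesis
    proof cases
      case (2 q)
      then have "Phi_mu q \<notin> insert i B" using compl that unfolding complementary_def by blast
      then have "Phi_mu q \<notin> tree_set" using sub by blast
      then show ?thesis using 2 by simp
    next
      case (3 q)
      then have "Phi_x q \<notin> insert i B" using compl that unfolding complementary_def by blast
      then have "Phi_x q \<notin> tree_set" using sub by blast
      then show ?thesis using 3 by simp
    qed simp
  qed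
  then have "insert i B = insert Omega tree_set" using sub by blast
  then have B_eq: "B = start_set p" using i'(2) ip(1) by (auto simp: start_set_def)
  \<comment> \<open>Otherwise letting \<open>Phi_mu p\<close> enter and \<open>Phi_mu p0\<close>
    leave would be a feasible pivot along a ray.\<close>
  have "p = p0"
  proof (rule ccontr)
    assume "p \<noteq> p0"
    have "start_set p \<union> {Phi_mu p} - {Phi_mu p0} = start_set p0"
      using p0 p(1) ip(2) \<open>p \<noteq> p0\<close> by (auto simp: start_set_def e_eq split: if_splits)
    then show False
      using ray_no_leaving[of "start_set p" "Phi_mu p" primary_ray "Phi_mu p0"]
        direction_start_set[of p] p(1) ip(2) B(1) B_eq start \<open>p \<noteq> p0\<close> primary_ray_nonneg i'(2) ip(1)
      by (auto simp: e_eq split: if_splits)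
  qed
  then show "i = Phi_mu p0" "B = start_set p0" using ip(1) B_eq by simp_all
qed

section \<open>Solutions at the end and feasible bases at the start\<close>

lemma feasible_imp_MNEP_solution:
  assumes B: "fcb B" "Omega \<notin> B"
  obtains x \<mu> \<pi> where "basic_solution N e B (x, \<mu>, 0, \<pi>)" "MNEP_solution N x \<mu> \<pi>"
proof -
  have basis: "tableau.basis e B" using B(1) by (simp add: tableau.feasible_def)
  obtain w where w: "tableau.solves e (rhs N) B w" "\<forall>i\<in>index_set N. w (Inl i) \<ge> 0"
    using B(1) by (auto simp: tableau.feasible_def)
  obtain x \<mu> \<omega> \<pi> where weq: "w = vec (x, \<mu>, \<omega>, \<pi>)" by (rule vec_surj)
  have flow: "\<And>c. c \<in> nonsource N \<Longrightarrow> excess x c = rhs N (Inl c)"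
    and row: "\<And>p. p \<in> pairs N \<Longrightarrow> cost x p - \<mu> p + e p * \<omega> + drop_along \<pi> p = rhs N (Inr p)"
    and supp: "\<And>i. i \<notin> B \<Longrightarrow> coordinate x \<mu> \<omega> i = 0" "\<And>c. c \<notin> nonsource N \<Longrightarrow> \<pi> c = 0"
    using w(1) unfolding weq solves_iff by auto
  have \<omega>: "\<omega> = 0" using supp(1)[OF B(2)] by simp
  show ?thesis
  proof
    show "basic_solution N e B (x, \<mu>, 0, \<pi>)" using basic_solution_iff[OF basis] w(1) weq \<omega> by simp
    show "MNEP_solution N x \<mu> \<pi>"
      unfolding MNEP_solution_def
    proof (intro conjI)
      show "\<forall>p\<in>pairs N. x p \<ge> 0 \<and> \<mu> p \<ge> 0" using w(2) weq by (auto simp: index_set_def ball_Un)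
      show "flow_conservation N x" using flow unfolding flow_conservation_iff by auto
      show "\<forall>(a, k)\<in>pairs N. slope N k a * total_flow N x a + \<pi> (tail (graph N) a, k)
          - \<pi> (head (graph N) a, k) - \<mu> (a, k) = - offset N k a"
      proof (intro ballI, clarify)
        fix a k assume p: "(a, k) \<in> pairs N"
        show "slope N k a * total_flow N x a + \<pi> (tail (graph N) a, k)
          - \<pi> (head (graph N) a, k) - \<mu> (a, k) = - offset N k a"
          using row[OF p] drop_along_eq[OF p supp(2)] \<omega> by (simp add: cost_def)
      qed
      show "\<forall>p\<in>pairs N. x p * \<mu> p = 0"
      proof
        fix p assume "p \<in> pairs N"
        then show "x p * \<mu> p = 0"
          using B(1) supp(1)[of "Phi_x p"] supp(1)[of "Phi_mu p"] by (auto simp: complementary_def)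
      qed
      show "\<forall>k\<in>classes N. \<pi> (source N k, k) = 0" using supp(2) by (simp add: nonsource_def)
    qed
  qed
qed

text \<open>Zero is a lower bound for \<open>\<omega>\<close>, so the optimality clause in the
  stopping test is automatic.\<close>

lemma AMNEP_optimalI: "MNEP_solution N x \<mu> \<pi> \<Longrightarrow> AMNEP_optimal N e (x, \<mu>, 0, \<pi>)"
  by (simp add: MNEP_solution_def)

lemma stops_immediately_iff: "stops_immediately N T \<longleftrightarrow> fcb tree_set"
proof -
  have eq: "initial_set N T - {Omega} = tree_set" by (simp add: initial_set_eq)
  show ?thesis
  proof
    assume fcb: "fcb tree_set"
    then obtain x \<mu> \<pi> where "basic_solution N e tree_set (x, \<mu>, 0, \<pi>)" "MNEP_solution N x \<mu> \<pi>"
      by (rule feasible_imp_MNEP_solution) simp_all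
    then show "stops_immediately N T"
      unfolding stops_immediately_def Let_def feasible_basis_iff e_def[symmetric] eq
      using fcb AMNEP_optimalI by blast
  next
    assume "stops_immediately N T"
    then show "fcb tree_set"
      unfolding stops_immediately_def Let_def feasible_basis_iff e_def[symmetric] eq by blast
  qed
qed

text \<open>In the basic solution of \<open>tree_set\<close> the flow is the nonnegative tree flow,
  so only \<open>\<mu>\<close> off the trees can be negative. Moving along the primary ray repairs
  this.\<close>

lemma exists_init: "\<exists>c. lemke_init N T c"
proof (cases "stops_immediately N T")
  case True
  then show ?thesis using lemke_init.intros(1) by blast
next
  case False
  have compl: "complementary N tree_set"
    by (rule complementary_mono[OF complementary_tree_set]) auto
  obtain w where w: "tableau.solves e (rhs N) tree_set w"
    using tableau.exists_solves[OF basis_tree_set] .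
  obtain x \<mu> \<omega> \<pi> where weq: "w = vec (x, \<mu>, \<omega>, \<pi>)" by (rule vec_surj)
  have supp: "coordinate x \<mu> \<omega> i = 0" if "i \<notin> tree_set" for i
    using w that unfolding weq solves_iff by auto
  have x_nonneg: "x p \<ge> 0" if "p \<in> pairs N" for p
  proof -
    have "x p = tree_flow p"
      using supp[of "Phi_x _"] by (intro tree_flow_eq[OF w[unfolded weq] _ that]) auto
    then show ?thesis using tree_flow_nonneg[OF that] by simp
  qed
  have \<omega>0: "\<omega> = 0" using supp[of Omega] by simp
  have \<mu>_off: "\<mu> p = 0" if "on_tree p" for p using supp[of "Phi_mu p"] that by simp
  let ?J = "{p\<in>pairs N. \<not> on_tree p}"
  have neg: "\<exists>p\<in>?J. \<mu> p < 0"
  proof (rule ccontr)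
    assume "\<not> ?thesis"
    then have off: "\<not> \<mu> p < 0" if "p \<in> pairs N" "\<not> on_tree p" for p using that by blast
    have "\<mu> p \<ge> 0" if "p \<in> pairs N" for p
      using that off[of p] \<mu>_off[of p] by (cases "on_tree p") simp_all
    then have "\<forall>i\<in>index_set N. w (Inl i) \<ge> 0"
      using x_nonneg \<omega>0 by (auto simp: index_set_def weq)
    then have "tableau.feasible e tree_set"
      using w basis_tree_set unfolding tableau.feasible_def by blast
    then show False using False compl stops_immediately_iff by blast
  qed
  have J: "finite ?J" using finite_pairs by simp
  define p where "p = arg_min_on \<mu> ?J"
  have p: "p \<in> ?J" unfolding p_def using arg_min_if_finite(1)[OF J] neg by blast
  have min: "\<mu> p \<le> \<mu> q" if "q \<in> ?J" for q
    unfolding p_def using arg_min_least[OF J] that by blast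
  have \<mu>p: "\<mu> p < 0" using neg min by force
  let ?w = "\<lambda>c. w c + (- \<mu> p) * primary_ray c"
  have "tableau.solves e (\<lambda>r. rhs N r + (- \<mu> p) * 0) (insert Omega tree_set) ?w"
    by (intro tableau.solves_add solves_primary_ray tableau.solves_mono[OF w]) auto
  moreover have "?w (Inl (Phi_mu p)) = 0" using p by (simp add: weq)
  ultimately have "tableau.solves e (rhs N) (start_set p) ?w"
    by (auto simp: tableau.solves_def start_set_def)
  moreover have "?w (Inl i) \<ge> 0" if i: "i \<in> index_set N" for i
  proof -
    consider q where "i = Phi_x q" "q \<in> pairs N" | q where "i = Phi_mu q" "q \<in> pairs N" | "i = Omega"
      using i by (auto simp: index_set_def)
    then show ?thesis
    proof cases
      case (2 q)
      then show ?thesis using min[of q] \<mu>_off[of q] by (auto simp: weq)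
    qed (use x_nonneg \<omega>0 \<mu>p in \<open>simp_all add: weq\<close>)
  qed
  ultimately have "tableau.feasible e (start_set p)"
    using basis_start_set p unfolding tableau.feasible_def by blast
  then have "feasible_complementary_basis N (tree_vector T) (start_set p)"
    using complementary_start_set by (simp add: feasible_basis_iff e_def[symmetric])
  then show ?thesis
    using lemke_init.intros(2)[OF False, of p "start_set p"] start_set_eq p by blast
qed

end

section \<open>The path of bases\<close>

context tree_network
begin

lemma feasible_complementary_basis_iff: "feasible_complementary_basis N e B \<longleftrightarrow> fcb B"
  by (simp add: feasible_basis_iff)

fun pair_of :: "('a, 'k) index \<Rightarrow> 'a \<times> 'k" where
  "pair_of (Phi_x p) = p"
| "pair_of (Phi_mu p) = p"
| "pair_of Omega = undefined"

text \<open>A basis has as many elements as there are pairs, and complementarity makes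
  \<open>pair_of\<close> injective apart from \<open>Omega\<close>. Hence \<open>Omega\<close>, if
  present, displaces exactly one pair.\<close>

lemma card_missing_pairs:
  assumes B: "tableau.basis e B" "complementary N B"
  shows "card {p\<in>pairs N. Phi_x p \<notin> B \<and> Phi_mu p \<notin> B} = of_bool (Omega \<in> B)"
proof -
  let ?U = "{p\<in>pairs N. Phi_x p \<notin> B \<and> Phi_mu p \<notin> B}"
  have BI: "B \<subseteq> index_set N" using B(1) by (rule tableau.basisD)
  have inj: "inj_on pair_of (B - {Omega})"
  proof (rule inj_onI)
    fix i j assume ij: "i \<in> B - {Omega}" "j \<in> B - {Omega}" "pair_of i = pair_of j"
    then have "i \<in> index_set N" using BI by auto
    then show "i = j"
      using ij B(2) by (cases i; cases j) (auto simp: complementary_def index_set_def)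
  qed
  have "pair_of ` (B - {Omega}) = pairs N - ?U"
  proof
    show "pair_of ` (B - {Omega}) \<subseteq> pairs N - ?U" using BI by (auto simp: index_set_def)
    show "pairs N - ?U \<subseteq> pair_of ` (B - {Omega})"
    proof
      fix p assume "p \<in> pairs N - ?U"
      then consider "Phi_x p \<in> B - {Omega}" | "Phi_mu p \<in> B - {Omega}" by auto
      then show "p \<in> pair_of ` (B - {Omega})" by cases (metis pair_of.simps imageI)+
    qed
  qed
  then have "card (B - {Omega}) = card (pairs N) - card ?U"
    using card_image[OF inj] finite_pairs by (simp add: card_Diff_subset)
  moreover have "card (B - {Omega}) = card (pairs N) - of_bool (Omega \<in> B)"
    using card_basis[OF B(1)] by simp
  moreover have "card ?U \<le> card (pairs N)" using finite_pairs by (intro card_mono) auto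
  \<comment> \<open>Rules out truncation in the subtraction of natural numbers above.\<close>
  moreover have "of_bool (Omega \<in> B) \<le> card (pairs N)"
    using card_basis[OF B(1)] tableau.basisD(2)[OF B(1)] card_gt_0_iff[of B] by auto
  ultimately show ?thesis by linarith
qed

lemma twin_indices_empty:
  assumes "fcb B" "Omega \<notin> B"
  shows "twin_indices N B = {}"
proof -
  have "{p\<in>pairs N. Phi_x p \<notin> B \<and> Phi_mu p \<notin> B} = {}"
    using card_missing_pairs[of B] assms finite_pairs by (simp add: tableau.feasible_def)
  then show ?thesis unfolding twin_indices_def by simp
qed

lemma twin_indices_eq:
  assumes "fcb B" "Omega \<in> B" "i \<in> twin_indices N B"
  shows "twin_indices N B = {i, twin i}"
proof -
  obtain p where p: "{p\<in>pairs N. Phi_x p \<notin> B \<and> Phi_mu p \<notin> B} = {p}"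
    using card_missing_pairs[of B] assms by (auto simp: tableau.feasible_def card_1_singleton_iff)
  then have eq: "twin_indices N B = {Phi_x p, Phi_mu p}" unfolding twin_indices_def by simp
  then have "i = Phi_x p \<or> i = Phi_mu p" using assms(3) by simp
  then show ?thesis unfolding eq by auto
qed

text \<open>Either twin may be the entering one, so the set is closed under reversal; its members
  need not be reachable.\<close>

inductive_set states :: "('a, 'k) config set" where
  "fcb B \<Longrightarrow> Omega \<in> B \<Longrightarrow> i \<in> twin_indices N B \<Longrightarrow> Running B i \<in> states"

inductive_cases statesE: "Running B i \<in> states"

lemma finite_states: "finite states"
proof (rule finite_subset)
  show "states \<subseteq> (\<lambda>(B, i). Running B i) ` (Pow (index_set N) \<times> index_set N)"
  proof
    fix s assume "s \<in> states"
    then show "s \<in> (\<lambda>(B, i). Running B i) ` (Pow (index_set N) \<times> index_set N)"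
    proof cases
      case (1 B i)
      then have "B \<in> Pow (index_set N)" "i \<in> index_set N"
        using twin_indices_props by (auto simp: tableau.feasible_def tableau.basis_def)
      then show ?thesis using 1(1) by auto
    qed
  qed
qed (use finite_index_set in simp)

text \<open>After a pivot the entering index is the twin of the one that has just left. Exchanging
  the twins thus makes the next pivot undo the last one.\<close>

fun reverse :: "('a, 'k) config \<Rightarrow> ('a, 'k) config" where
  "reverse (Running B i) = Running B (twin i)"
| "reverse (Stopped B) = Stopped B"

lemma leaving_iff: "leaving N e B i j \<longleftrightarrow> j \<noteq> i \<and> fcb (B \<union> {i} - {j})"
  unfolding leaving_def feasible_complementary_basis_iff ..

lemma leaving_ex1:
  assumes s: "Running B i \<in> states" and j: "leaving N e B i j"
  shows "\<exists>!j'. leaving N e B i j'"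
proof -
  have B: "fcb B" "Omega \<in> B" "i \<in> twin_indices N B" using s by (auto elim: statesE)
  note i = twin_indices_props[OF B(3)]
  show ?thesis
    using j B(1) leaving_unique[of B i] i unfolding leaving_iff by blast
qed

text \<open>If \<open>Omega\<close> leaves, no pair is missing. Otherwise the pair of
  \<open>j\<close> is: its twin was excluded by complementarity and is not the entering
  \<open>i\<close>, because \<open>twin i\<close> is not in \<open>B\<close>.\<close>

lemma pivot:
  assumes s: "Running B i \<in> states" and j: "leaving N e B i j"
  shows "j \<in> B" "j = Omega \<Longrightarrow> twin_indices N (B \<union> {i} - {j}) = {}"
    "j \<noteq> Omega \<Longrightarrow> twin_indices N (B \<union> {i} - {j}) = {j, twin j}"
    "j \<noteq> Omega \<Longrightarrow> Running (B \<union> {i} - {j}) j \<in> states"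
proof -
  have B: "fcb B" "Omega \<in> B" "i \<in> twin_indices N B" using s by (auto elim: statesE)
  note i = twin_indices_props[OF B(3)]
  let ?B = "B \<union> {i} - {j}"
  have B': "fcb ?B" "j \<noteq> i" using j by (simp_all add: leaving_iff)
  show jB: "j \<in> B"
    using tableau.leaving_in[of e B i j] B B' i by (simp add: tableau.feasible_def)
  show "twin_indices N ?B = {}" if "j = Omega"
    using that by (intro twin_indices_empty[OF B'(1)]) simp
  assume jo: "j \<noteq> Omega"
  then have o: "Omega \<in> ?B" using B(2) by simp
  have "j \<in> index_set N" using jB B(1) by (auto simp: tableau.feasible_def tableau.basis_def)
  have twin_i: "twin i \<notin> B" using B(3) by (auto simp: twin_indices_def)
  have "j \<in> twin_indices N ?B"
  proof -
    have "twin j \<notin> B"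
      using jB jo \<open>j \<in> index_set N\<close> B(1) by (cases j) (auto simp: complementary_def index_set_def)
    moreover have "twin j \<noteq> i" using twin_i jB by auto
    ultimately have "twin j \<notin> ?B" "j \<notin> ?B" by simp_all
    then show ?thesis
      using jo \<open>j \<in> index_set N\<close> by (cases j) (auto simp: twin_indices_def index_set_def)
  qed
  then show "twin_indices N ?B = {j, twin j}" "Running ?B j \<in> states"
    using twin_indices_eq[OF B'(1) o] states.intros[OF B'(1) o] by blast+
qed

lemma step_exists:
  assumes s: "Running B i \<in> states" and j: "leaving N e B i j"
  shows "\<exists>c. lemke_step N e (Running B i) c"
proof (cases "j = Omega")
  case True
  then show ?thesis
    using lemke_step.intros(1)[OF j leaving_ex1[OF s j] refl pivot(2)[OF s j]] by blast
next
  case False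
  then show ?thesis
    using lemke_step.intros(2)[OF j leaving_ex1[OF s j] refl pivot(3)[OF s j]] twin_neq by blast
qed

lemma step_cases:
  assumes s: "Running B i \<in> states" and step: "lemke_step N e (Running B i) c"
  obtains j where "leaving N e B i j" "j = Omega" "c = Stopped (B \<union> {i} - {j})"
  | j where "leaving N e B i j" "j \<noteq> Omega" "c = Running (B \<union> {i} - {j}) (twin j)"
  using step
proof cases
  case (1 j B')
  then have "j = Omega" using pivot(3)[OF s] by auto
  then show ?thesis using that(1) 1 by blast
next
  case (2 j B' i')
  then have j: "j \<noteq> Omega" using pivot(2)[OF s] by auto
  have "i' = twin j" using pivot(3)[OF s 2(2) j] 2 by auto
  with j show ?thesis using that(2) 2 by blast
qed

text \<open>Only steps between running configurations are reversible; the final step is treated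
  separately.\<close>

definition running_step :: "('a, 'k) config \<Rightarrow> ('a, 'k) config \<Rightarrow> bool" where
  "running_step s t \<longleftrightarrow> lemke_step N e s t \<and> (\<exists>B i. t = Running B i)"

lemma running_stepE:
  assumes "s \<in> states" "running_step s t"
  obtains B i j where "s = Running B i" "Running B i \<in> states" "leaving N e B i j" "j \<noteq> Omega"
    "t = Running (B \<union> {i} - {j}) (twin j)"
proof -
  obtain B i where s: "s = Running B i" using assms(1) by (auto elim: states.cases)
  have step: "lemke_step N e (Running B i) t" and st: "Running B i \<in> states"
    using assms s by (simp_all add: running_step_def)
  from st step show ?thesis
  proof (cases rule: step_cases)
    case (1 j)
    then show ?thesis using assms(2) by (simp add: running_step_def)
  next
    case (2 j)
    then show ?thesis using s st that by blast
  qed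
qed

lemma reverse_in_states:
  assumes "s \<in> states"
  shows "reverse s \<in> states"
  using assms
proof cases
  case (1 B i)
  have "twin i \<in> twin_indices N B" using twin_indices_eq[OF 1(2,3,4)] by blast
  then show ?thesis using states.intros[OF 1(2,3)] 1(1) by simp
qed

text \<open>From the new basis, letting \<open>j\<close> enter and \<open>i\<close> leave restores
  \<open>B\<close>, whose other twin enters next. The two states have different bases, since only
  the new one contains \<open>i\<close>.\<close>

lemma reverse_step:
  assumes s: "s \<in> states" and st: "running_step s t"
  shows "t \<in> states" "running_step (reverse t) (reverse s)" "t \<noteq> reverse s"
proof -
  obtain B i j where eq: "s = Running B i" "Running B i \<in> states" "leaving N e B i j" "j \<noteq> Omega"
    "t = Running (B \<union> {i} - {j}) (twin j)"
    using running_stepE[OF assms] .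
  let ?B = "B \<union> {i} - {j}"
  have B: "fcb B" "Omega \<in> B" "i \<in> twin_indices N B" using eq(2) by (auto elim: statesE)
  note i = twin_indices_props[OF B(3)]
  note j = pivot(1)[OF eq(2,3)] pivot(4)[OF eq(2,3,4)]
  show "t \<in> states" using reverse_in_states[OF j(2)] eq(5) by simp
  have back_set: "?B \<union> {j} - {i} = B" using i(2) j(1) by auto
  have back_leaving: "leaving N e ?B j i" using B i j(1) unfolding leaving_iff back_set by auto
  have "lemke_step N e (Running ?B j) (Running B (twin i))"
    using lemke_step.intros(2)[OF back_leaving leaving_ex1[OF j(2) back_leaving] back_set[symmetric]]
      twin_indices_eq[OF B] twin_neq[OF i(3)] by blast
  then show "running_step (reverse t) (reverse s)" by (simp add: running_step_def eq)
  show "t \<noteq> reverse s" using i(2) eq(1,5) j(1) by auto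
qed

lemma final_state:
  assumes "fcb B" "Omega \<notin> B"
  shows "\<exists>B' x \<mu> \<pi>. Stopped B = Stopped B' \<and>
    feasible_complementary_basis N e B' \<and> Omega \<notin> B' \<and>
    basic_solution N e B' (x, \<mu>, 0, \<pi>) \<and> MNEP_solution N x \<mu> \<pi>"
proof -
  obtain x \<mu> \<pi> where "basic_solution N e B (x, \<mu>, 0, \<pi>)" "MNEP_solution N x \<mu> \<pi>"
    by (rule feasible_imp_MNEP_solution[OF assms])
  then show ?thesis
    using assms unfolding feasible_complementary_basis_iff
    by (intro exI[of _ B] exI[of _ x] exI[of _ \<mu>] exI[of _ \<pi>]) simp
qed

lemma stopped_stuck: "\<not> lemke_step N e (Stopped B) c"
  by (auto elim: lemke_step.cases)

end

section \<open>Runs from a given feasible starting basis\<close>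

locale started_tree_network = tree_network +
  fixes p0
  assumes start_feasible: "fcb (start_set p0)"
begin

lemma p0: "p0 \<in> pairs N" "\<not> on_tree p0"
  using start_off_tree start_feasible by (auto simp: tableau.feasible_def)

lemma start_twins: "Phi_x p0 \<in> twin_indices N (start_set p0)"
  using p0 by (auto simp: twin_indices_def start_set_def)

sublocale reversible_steps states running_step reverse "Running (start_set p0) (Phi_x p0)"
proof
  show "finite states" by (rule finite_states)
  show "Running (start_set p0) (Phi_x p0) \<in> states"
    using start_feasible start_twins by (intro states.intros) (auto simp: start_set_def)
  show "t \<in> states" "running_step (reverse t) (reverse s)" "t \<noteq> reverse s"
    if "s \<in> states" "running_step s t" for s t
    using reverse_step[OF that] by auto
  show "t = t'" if "s \<in> states" "running_step s t" "running_step s t'" for s t t'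
    using running_stepE[OF that(1,2)] running_stepE[OF that(1,3)] leaving_ex1 by (metis config.inject(1))
  show "reverse s \<in> states" if "s \<in> states" for s using reverse_in_states[OF that] .
  show "reverse (reverse s) = s" for s by (cases s) auto
  show "reverse s \<noteq> s" if "s \<in> states" for s
    using that
  proof cases
    case (1 B i)
    then show ?thesis using twin_neq[OF twin_indices_props(3)[OF 1(4)]] by simp
  qed
  \<comment> \<open>Here \<open>Phi_mu p0\<close> enters, and its direction is the primary
    ray.\<close>
  show "\<not> running_step (reverse (Running (start_set p0) (Phi_x p0))) t" for t
  proof
    assume "running_step (reverse (Running (start_set p0) (Phi_x p0))) t"
    then obtain j where "leaving N e (start_set p0) (Phi_mu p0) j"
      by (auto simp: running_step_def elim: lemke_step.cases)
    then show False
      using ray_no_leaving[OF _ _ _ direction_start_set[OF p0] primary_ray_nonneg] start_feasible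
      by (auto simp: leaving_iff start_set_def)
  qed
qed

text \<open>Without a negative entry the direction is a ray, and \<open>secondary_ray\<close>
  identifies the state as the reversed start. Otherwise the ratio test gives a pivot, which stays
  complementary because a twin enters.\<close>

lemma progress:
  assumes "s \<in> states" "s \<noteq> Running (start_set p0) (Phi_mu p0)"
  shows "\<exists>c. lemke_step N e s c"
  using assms(1)
proof cases
  case (1 B i)
  note i = twin_indices_props[OF 1(4)]
  have feas: "tableau.feasible e B" using 1(2) by simp
  then obtain d where d: "tableau.direction e B i d"
    using tableau.exists_direction[of e B i] i by (auto simp: tableau.feasible_def)
  have "\<exists>k\<in>index_set N. d (Inl k) < 0"
  proof (rule ccontr)
    assume "\<not> ?thesis"
    then have ray: "d (Inl k) \<ge> 0" if "k \<in> index_set N" for k using that by (simp add: not_less)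
    note secondary_ray[OF 1(2,3,4) d ray conjunct1[OF start_feasible]]
    then show False using assms(2) 1(1) by simp
  qed
  then obtain j where j: "j \<in> B" "tableau.feasible e (B \<union> {i} - {j})"
    using tableau.ratio_test[OF feas i(1,2) d] by blast
  have "complementary N (B \<union> {i} - {j})"
    by (rule complementary_mono[OF complementary_insert[of B i]]) (use 1 in auto)
  then have "leaving N e B i j" using j i(2) by (auto simp: leaving_iff)
  then show ?thesis using step_exists 1(1) assms(1) by blast
qed

lemma reachable_configs:
  assumes "(lemke_step N e)\<^sup>*\<^sup>* (Running (start_set p0) (Phi_x p0)) c"
  shows "running_step\<^sup>*\<^sup>* (Running (start_set p0) (Phi_x p0)) c \<or>
    (\<exists>B. c = Stopped B \<and> fcb B \<and> Omega \<notin> B)"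
  using assms
proof (induction rule: rtranclp_induct)
  case (step c c')
  then have run: "running_step\<^sup>*\<^sup>* (Running (start_set p0) (Phi_x p0)) c"
    using stopped_stuck by blast
  then have c: "c \<in> states" by (rule reachable_not_reversed_start)
  then obtain B i where Bi: "c = Running B i" by (auto elim: states.cases)
  show ?case
  proof (cases c')
    case (Running B' i')
    then have "running_step c c'" using step.hyps(2) by (simp add: running_step_def)
    then show ?thesis using run by (meson rtranclp.rtrancl_into_rtrancl)
  next
    case (Stopped B')
    have "Running B i \<in> states" "lemke_step N e (Running B i) c'" using c step.hyps(2) Bi by simp_all
    then have "leaving N e B i Omega \<and> B' = B \<union> {i} - {Omega}"
      by (cases rule: step_cases) (simp_all add: Stopped)
    then show ?thesis using Stopped by (simp add: leaving_iff)
  qed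
qed simp

lemma terminal_config:
  assumes "(lemke_step N e)\<^sup>*\<^sup>* (Running (start_set p0) (Phi_x p0)) c" "\<nexists>c'. lemke_step N e c c'"
  obtains B where "c = Stopped B" "fcb B" "Omega \<notin> B"
  using reachable_configs[OF assms(1)]
proof
  assume "running_step\<^sup>*\<^sup>* (Running (start_set p0) (Phi_x p0)) c"
  then show ?thesis using reachable_not_reversed_start[of c] progress assms(2) by auto
qed (use that in blast)

lemma terminates:
  "\<nexists>run. run 0 = Running (start_set p0) (Phi_x p0) \<and> (\<forall>n. lemke_step N e (run n) (run (Suc n)))"
proof
  assume "\<exists>run. run 0 = Running (start_set p0) (Phi_x p0) \<and> (\<forall>n. lemke_step N e (run n) (run (Suc n)))"
  then obtain run where run: "run 0 = Running (start_set p0) (Phi_x p0)"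
    "\<And>n. lemke_step N e (run n) (run (Suc n))" by blast
  \<comment> \<open>Every configuration of an infinite run has a successor, so none is
    stopped.\<close>
  have "running_step (run n) (run (Suc n))" for n
    using run(2)[of n] run(2)[of "Suc n"] stopped_stuck
    by (cases "run (Suc n)") (auto simp: running_step_def)
  then show False using no_infinite_run run(1) by blast
qed

end

text \<open>The conclusion speaks of every admissible starting pair and every maximal run. A stuck
  running configuration would count as the end of a run, so the unique leaving index and the next
  entering twin are asserted to exist as well.\<close>

theorem theorem2:
  fixes N :: "('v, 'a, 'k) network" and T :: "'k \<Rightarrow> 'a set" and e :: "'a \<times> 'k \<Rightarrow> real"
  assumes "multiclass_network N"
    and "\<And>k. k \<in> classes N \<Longrightarrow> arborescence (class_graph N k) (source N k) (T k)"
    and "routable_on N T"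
    and "e = tree_vector T"
    and "nondegenerate N e"
  shows "(\<exists>c. lemke_init N T c) \<and>
    (\<forall>c. lemke_init N T c \<longrightarrow>
      (\<nexists>run. run 0 = c \<and> (\<forall>n. lemke_step N e (run n) (run (Suc n)))) \<and>
      (\<forall>c'. (lemke_step N e)\<^sup>*\<^sup>* c c' \<and> (\<nexists>c''. lemke_step N e c' c'') \<longrightarrow>
        (\<exists>B x \<mu> \<pi>. c' = Stopped B \<and>
          feasible_complementary_basis N e B \<and> Omega \<notin> B \<and>
          basic_solution N e B (x, \<mu>, 0, \<pi>) \<and> MNEP_solution N x \<mu> \<pi>)))"
proof -
  interpret tree_network N T e
    using assms by (simp add: tree_network_def tree_network_axioms_def)
  show ?thesis
  proof (intro conjI allI impI)
    show "\<exists>c. lemke_init N T c" by (rule exists_init)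
  next
    fix c assume "lemke_init N T c"
    then show "\<nexists>run. run 0 = c \<and> (\<forall>n. lemke_step N e (run n) (run (Suc n)))"
    proof cases
      case 1
      then show ?thesis using stopped_stuck by metis
    next
      case (2 p B)
      interpret started_tree_network N T e p
        using 2 by unfold_locales (auto simp: start_set_eq feasible_basis_iff e_def[symmetric])
      show ?thesis using terminates 2 by (simp add: start_set_eq)
    qed
  next
    fix c c' assume "lemke_init N T c"
      and c': "(lemke_step N e)\<^sup>*\<^sup>* c c' \<and> (\<nexists>c''. lemke_step N e c' c'')"
    then have "\<exists>B. c' = Stopped B \<and> fcb B \<and> Omega \<notin> B"
    proof cases
      case 1
      then have "c' = Stopped tree_set"
        using c' stopped_stuck by (auto simp: initial_set_eq elim: converse_rtranclpE)
      then show ?thesis using 1 stops_immediately_iff by simp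
    next
      case (2 p B)
      interpret started_tree_network N T e p
        using 2 by unfold_locales (auto simp: start_set_eq feasible_basis_iff e_def[symmetric])
      have "c = Running (start_set p) (Phi_x p)" using 2 by (simp add: start_set_eq)
      then show ?thesis using terminal_config[of c'] c' by blast
    qed
    then show "\<exists>B x \<mu> \<pi>. c' = Stopped B \<and>
        feasible_complementary_basis N e B \<and> Omega \<notin> B \<and>
        basic_solution N e B (x, \<mu>, 0, \<pi>) \<and> MNEP_solution N x \<mu> \<pi>"
      using final_state by blast
  qed
qed

end
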